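(* Let $n\ge 1$, let $P\in\mathscr{P}_n$ be a polynomial which does not vanish in $|z|<1$, let $B\in\mathcal{B}_n$ have parameters $\lambda_0,\lambda_1,\lambda_2$, and put $m=\min_{|z|=1}|P(z)|$. Then for every $\delta\in\mathbb{C}$ with $|\delta|\le 1$, every $0\le p<\infty$ and every $R>1$, with $\sigma(z)=Rz$, $$\left\|B[P\circ\sigma](z)+\delta\left\{\frac{\left(R^n|\Lambda_n|-|\lambda_0|\right)m}{2}\right\}\right\|_p\le\frac{\left\|R^n\Lambda_n z+\lambda_0\right\|_p}{\|1+z\|_p}\,\|P(z)\|_p .$$ The result is best possible: equality holds for $P(z)=az^n+b$ with $|a|=|b|=1$.
   Context: $\mathscr{P}_n$ is the space of complex polynomials of degree at most $n$. For a polynomial $Q$, define $\|Q(z)\|_0:=\exp\left\{\frac1{2\pi}\int_0^{2\pi}\log|Q(e^{i\theta})|\,d\theta\right\}$ and, for $0<p<\infty$, $\|Q(z)\|_p:=\left\{\frac1{2\pi}\int_0^{2\pi}|Q(e^{i\theta})|^p\,d\theta\right\}^{1/p}$. $P\circ\sigma$ denotes the composite $(P\circ\sigma)(z)=P(\sigma(z))$. The class $\mathcal{B}_n$ consists of the operators $B$ carrying $P\in\mathscr{P}_n$ into $$B[P](z):=\lambda_0P(z)+\lambda_1\left(\frac{nz}{2}\right)\frac{P'(z)}{1!}+\lambda_2\left(\frac{nz}{2}\right)^2\frac{P''(z)}{2!},$$ where $\lambda_0,\lambda_1,\lambda_2\in\mathbb{C}$ are such that all the zeros of $U(z):=\lambda_0+\lambda_1\binom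 n1 z+\lambda_2\binom n2 z^2$ lie in the half plane $|z|\le|z-n/2|$. Also $\Lambda_n:=\lambda_0+\lambda_1\frac{n^2}{2}+\lambda_2\frac{n^3(n-1)}{8}$. *)

theory Defs
  imports "HOL-Analysis.Analysis" "HOL-Computational_Algebra.Polynomial"
begin

text \<open>
  The quantities \<open>\<parallel>Q\<parallel>\<^sub>p\<close> for \<open>0 \<le> p < \<infinity>\<close> on the unit circle. For \<open>Q \<noteq> 0\<close> the function
  \<open>\<theta> \<mapsto> log \<bar>Q (e\<^sup>i\<^sup>\<theta>)\<bar>\<close> is integrable and the convention \<open>ln 0 = 0\<close> affects only finitely many
  points. For \<open>Q = 0\<close> the integrand is \<open>-\<infinity>\<close> everywhere, so that \<open>\<parallel>0\<parallel>\<^sub>0 = exp (-\<infinity>) = 0\<close>; this has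
  to be a separate case because of \<open>ln 0 = 0\<close>.
\<close>

definition circle_norm :: "real \<Rightarrow> complex poly \<Rightarrow> real" where
  "circle_norm p Q =
     (if p = 0 then
        (if Q = 0 then 0
         else exp (1 / (2 * pi) * (LBINT t:{0..2 * pi}. ln (cmod (poly Q (cis t))))))
      else (1 / (2 * pi) * (LBINT t:{0..2 * pi}. cmod (poly Q (cis t)) powr p)) powr (1 / p))"

text \<open>The infimum is a minimum, the circle being compact.\<close>

definition circle_min :: "complex poly \<Rightarrow> real" where
  "circle_min P = (INF z\<in>sphere 0 1. cmod (poly P z))"

definition U_poly :: "nat \<Rightarrow> complex \<Rightarrow> complex \<Rightarrow> complex \<Rightarrow> complex poly" where
  "U_poly n l0 l1 l2 = [:l0, l1 * of_nat (n choose 1), l2 * of_nat (n choose 2):]"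

text \<open>
  The parameter condition defining the class \<open>\<B>\<^sub>n\<close>. It is vacuous if \<open>U\<close> is a nonzero constant
  and excludes \<open>U = 0\<close>, of which every complex number is a zero.
\<close>

definition B_params :: "nat \<Rightarrow> complex \<Rightarrow> complex \<Rightarrow> complex \<Rightarrow> bool" where
  "B_params n l0 l1 l2 \<longleftrightarrow>
     (\<forall>z. poly (U_poly n l0 l1 l2) z = 0 \<longrightarrow> cmod z \<le> cmod (z - of_nat n / 2))"

definition B_op :: "nat \<Rightarrow> complex \<Rightarrow> complex \<Rightarrow> complex \<Rightarrow> complex poly \<Rightarrow> complex poly" where
  "B_op n l0 l1 l2 P =
     smult l0 P
     + smult (l1 / fact 1) ([:0, of_nat n / 2:] * pderiv P)
     + smult (l2 / fact 2) ([:0, of_nat n / 2:] ^ 2 * pderiv (pderiv P))"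

definition Lambda :: "nat \<Rightarrow> complex \<Rightarrow> complex \<Rightarrow> complex \<Rightarrow> complex" where
  "Lambda n l0 l1 l2 =
     l0 + l1 * (of_nat n ^ 2 / 2) + l2 * (of_nat n ^ 3 * (of_nat n - 1) / 8)"

text \<open>The polynomial \<open>B[P \<circ> \<sigma>](z) + \<delta> (R\<^sup>n \<bar>\<Lambda>\<^sub>n\<bar> - \<bar>\<lambda>\<^sub>0\<bar>) m / 2\<close> with \<open>\<sigma> z = R z\<close>.\<close>

definition perturbed_B ::
  "nat \<Rightarrow> complex \<Rightarrow> complex \<Rightarrow> complex \<Rightarrow> real \<Rightarrow> complex \<Rightarrow> complex poly \<Rightarrow> complex poly" where
  "perturbed_B n l0 l1 l2 R \<delta> P =
     B_op n l0 l1 l2 (P \<circ>\<^sub>p [:0, of_real R:])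
     + [:\<delta> * of_real ((R ^ n * cmod (Lambda n l0 l1 l2) - cmod l0) * circle_min P / 2):]"

end

theory Submission
  imports Defs "HOL-Probability.Probability" "HOL-Complex_Analysis.Complex_Analysis"
    "HOL-Computational_Algebra.Fundamental_Theorem_Algebra"
begin

text \<open>
  Write \<open>\<beta>\<close> for the polynomial \<open>B[P \<circ> \<sigma>]\<close> and \<open>S\<close> for the reciprocal \<open>z\<^sup>n cnj (B[Q \<circ> \<sigma>] (1 / cnj z))\<close>, where
  \<open>Q\<close> is the reciprocal of \<open>P\<close>. Both arise from \<open>P\<close> by multiplying the coefficients by fixed numbers: by
  some \<open>\<gamma>\<^sub>j\<close> for \<open>\<beta>\<close>, and by \<open>cnj \<gamma>\<^sub>n\<^sub>-\<^sub>j\<close> for \<open>S\<close>.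

  Geometry. The half-plane condition on the zeros of \<open>U\<close> means that the map \<open>P \<mapsto> S\<close> is a twofold polar
  derivative with poles of modulus at most \<open>\<bar>z\<bar>\<close>, up to a dilation and a constant
  factor (\<open>B_params_factor\<close>). By Laguerre's theorem it keeps polynomials zero-free in the disc (\<open>dual_dilated_B_nonzero\<close>). Operators with this property
  respect domination, which gives \<open>\<bar>\<beta>\<bar> \<le> \<bar>S\<bar>\<close> on the circle; subtracting constants of modulus below \<open>m\<close>
  from \<open>P\<close> improves this to \<open>\<bar>\<beta>\<bar> + 2 c \<le> \<bar>S\<bar>\<close> with \<open>2 c = (R\<^sup>n \<bar>\<Lambda>\<bar> - \<bar>\<lambda>\<^sub>0\<bar>) m\<close>
  (\<open>mult_op_le_dual_sharpened\<close>). By the maximum principle \<open>P \<mapsto> \<beta> + w S\<close> keeps polynomials zero-free as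
  well, for each unimodular \<open>w\<close> (\<open>preserves_zero_free_pencil\<close>).

  Analysis. An operator with multiplier \<open>\<mu>\<close> that keeps polynomials zero-free satisfies Arestov's
  inequality: it increases the \<open>p\<close>-norm at most by the factor \<open>\<bar>\<mu>\<^sub>0\<bar>\<close> (\<open>arestov\<close>). For the logarithmic mean
  this is Jensen's formula, after reflecting the zeros of \<open>P\<close> that lie in the disc. Shifting \<open>P\<close> by
  constants and averaging over their arguments replaces the logarithm by \<open>ln (max \<bar>\<cdot>\<bar> a)\<close>, and the
  functions \<open>u\<^sup>p\<close> are mixtures of such truncated logarithms.

  Conclusion. The perturbed polynomial has modulus at most \<open>\<bar>\<beta>\<bar> + c\<close>. For \<open>p > 0\<close>,
  Arestov's inequality for \<open>\<beta> + w S\<close> has the constant \<open>\<bar>\<lambda>\<^sub>0 + w R\<^sup>n cnj \<Lambda>\<bar>\<close>.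
  The sharpened inequality gives \<open>(\<bar>\<beta>\<bar> + c) \<bar>1 + w\<bar> \<le> \<bar>\<bar>\<beta>\<bar> + w \<bar>S\<bar>\<bar>\<close>, and integration over \<open>z\<close> and \<open>w\<close> yields the claim
  (\<open>power_mean_combine\<close>). For \<open>p = 0\<close> it is enough that \<open>\<bar>\<beta>\<bar> + c \<le> \<bar>S\<bar>\<close>, since \<open>S\<close> is zero-free with
  \<open>\<bar>S 0\<bar> = R\<^sup>n \<bar>\<Lambda>\<bar> \<bar>P 0\<bar>\<close>. For \<open>a z\<^sup>n + b\<close> with unimodular \<open>a\<close> and \<open>b\<close> the minimum \<open>m\<close> is \<open>0\<close>, and the norm of a
  binomial depends only on the moduli of its coefficients.
\<close>

section \<open>Arc length on the unit circle\<close>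

text \<open>
  Normalised arc length on the unit circle, as a measure on the plane; integrals against it are the
  means in \<^const>\<open>circle_norm\<close>, and Fubini applies to pairs of points of the circle.
\<close>

definition circ :: "complex measure" where
  "circ = distr (density lborel (\<lambda>t. ennreal (indicator {0..2 * pi} t / (2 * pi)))) borel cis"

lemma sets_circ [simp, measurable_cong]: "sets circ = sets borel"
  by (simp add: circ_def)

lemma space_circ [simp]: "space circ = UNIV"
  by (simp add: circ_def)

lemma measurable_circ [simp]: "measurable circ N = measurable borel N"
  by (intro measurable_cong_sets) simp_all

lemma cis_borel [measurable]: "cis \<in> borel \<rightarrow>\<^sub>M borel"
  by (intro borel_measurable_continuous_onI continuous_intros)

lemma poly_borel [measurable]: "poly (Q :: complex poly) \<in> borel \<rightarrow>\<^sub>M borel"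
  by (intro borel_measurable_continuous_onI continuous_intros)

lemma nn_integral_circ:
  assumes [measurable]: "f \<in> borel_measurable borel"
  shows "(\<integral>\<^sup>+z. f z \<partial>circ) = (\<integral>\<^sup>+t. ennreal (indicator {0..<2 * pi} t / (2 * pi)) * f (cis t) \<partial>lborel)"
proof -
  have "(\<integral>\<^sup>+z. f z \<partial>circ)
      = (\<integral>\<^sup>+t. ennreal (indicator {0..2 * pi} t / (2 * pi)) * f (cis t) \<partial>lborel)"
    unfolding circ_def by (subst nn_integral_distr) (simp_all add: nn_integral_density)
  also have "\<dots> = (\<integral>\<^sup>+t. ennreal (indicator {0..<2 * pi} t / (2 * pi)) * f (cis t) \<partial>lborel)"
    by (intro nn_integral_cong_AE eventually_mono[OF AE_lborel_singleton[of "2 * pi"]])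
       (auto simp: indicator_def)
  finally show ?thesis .
qed

lemma integral_circ:
  fixes f :: "complex \<Rightarrow> real"
  assumes [measurable]: "f \<in> borel_measurable borel"
  shows "1 / (2 * pi) * (LBINT t:{0..2 * pi}. f (cis t)) = (\<integral>z. f z \<partial>circ)"
proof -
  have "(\<integral>z. f z \<partial>circ) = (\<integral>t. (indicator {0..2 * pi} t / (2 * pi)) * f (cis t) \<partial>lborel)"
    unfolding circ_def by (subst integral_distr) (simp_all add: integral_density)
  also have "\<dots> = (\<integral>t. 1 / (2 * pi) * (indicator {0..2 * pi} t * f (cis t)) \<partial>lborel)"
    by (simp add: field_simps)
  also have "\<dots> = 1 / (2 * pi) * (LBINT t:{0..2 * pi}. f (cis t))"
    unfolding set_lebesgue_integral_def by (subst integral_mult_right_zero) simp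
  finally show ?thesis by simp
qed

interpretation circ: prob_space circ
proof
  have "emeasure circ (space circ) = (\<integral>\<^sup>+z. 1 \<partial>circ)" by simp
  also have "\<dots> = (\<integral>\<^sup>+t. ennreal (1 / (2 * pi)) * indicator {0..<2 * pi} t \<partial>lborel)"
    by (subst nn_integral_circ) (auto intro!: nn_integral_cong simp: indicator_def)
  also have "\<dots> = 1"
    by (subst nn_integral_cmult) (simp_all add: ennreal_mult'[symmetric])
  finally show "emeasure circ (space circ) = 1" .
qed

interpretation circ2: pair_sigma_finite circ circ ..

lemma AE_circ: "AE z in circ. cmod z = 1"
  unfolding circ_def by (subst AE_distr_iff) auto

lemma AE_circ_neq: "AE z in circ. z \<noteq> w"
proof -
  have fin: "finite {t \<in> {0..<2 * pi}. cis t = w}"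
  proof (cases "{t \<in> {0..<2 * pi}. cis t = w} = {}")
    case False
    then obtain s where s: "0 \<le> s" "s < 2 * pi" "cis s = w" by auto
    have "t = s" if t: "0 \<le> t" "t < 2 * pi" "cis t = w" for t
      using s t by (metis Arg2pi_unique cis_conv_exp mult_1 of_real_1 zero_less_one)
    hence "{t \<in> {0..<2 * pi}. cis t = w} \<subseteq> {s}" by auto
    thus ?thesis by (rule finite_subset) simp
  next
    case True
    thus ?thesis by (simp only: finite.emptyI)
  qed
  have "AE t in lborel. t \<notin> insert (2 * pi) {t \<in> {0..<2 * pi}. cis t = w}"
    using fin by (intro AE_not_in finite_imp_null_set_lborel) simp
  hence "AE t in lborel. t \<in> {0..2 * pi} \<longrightarrow> cis t \<noteq> w"
    by (rule eventually_mono) auto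
  thus ?thesis
    unfolding circ_def by (subst AE_distr_iff) (auto simp: AE_density indicator_def elim!: eventually_mono)
qed

lemma AE_circ_finite:
  assumes "finite A" shows "AE z in circ. z \<notin> A"
  using assms by (induction A rule: finite_induct) (simp_all add: AE_circ_neq eventually_conj)

lemma AE_circ_poly:
  assumes "(Q :: complex poly) \<noteq> 0" shows "AE z in circ. poly Q z \<noteq> 0"
  using AE_circ_finite[OF poly_roots_finite[OF assms]] by simp

lemma integrable_circ_continuous:
  fixes f :: "complex \<Rightarrow> real"
  assumes "continuous_on UNIV f"
  shows "integrable circ f"
proof -
  have "compact (f ` sphere 0 1)"
    by (intro compact_continuous_image continuous_on_subset[OF assms]) auto
  then obtain B where "\<And>z. cmod z = 1 \<Longrightarrow> norm (f z) \<le> B"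
    by (metis bounded_iff compact_imp_bounded dist_0_norm imageI mem_sphere)
  thus ?thesis
    by (intro circ.integrable_const_bound[of _ B] eventually_mono[OF AE_circ])
       (simp_all add: borel_measurable_continuous_onI[OF assms])
qed

lemma nn_integral_circ_rotate:
  assumes [measurable]: "f \<in> borel_measurable borel" and c: "cmod c = 1"
  shows "(\<integral>\<^sup>+z. f (c * z) \<partial>circ) = (\<integral>\<^sup>+z. f z \<partial>circ)"
proof -
  define a where "a = Arg2pi c"
  have a: "0 \<le> a" "a < 2 * pi" "c = cis a"
    using Arg2pi[of c] c by (auto simp: a_def cis_conv_exp is_Arg_def)
  define g where "g = (\<lambda>t. ennreal (1 / (2 * pi)) * f (cis t))"
  have [measurable]: "g \<in> borel_measurable borel" by (simp add: g_def)
  have per: "g (t + 2 * pi) = g t" for t by (simp add: g_def flip: cis_mult)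
  have shift: "(\<integral>\<^sup>+t. g (t + d) * indicator {x..<y} t \<partial>lborel)
      = (\<integral>\<^sup>+t. g t * indicator {x + d..<y + d} t \<partial>lborel)" for d x y
    by (subst nn_integral_real_affine[where c = 1 and t = d and f = "\<lambda>t. g t * indicator {x + d..<y + d} t"])
       (auto intro!: nn_integral_cong simp: indicator_def add.commute)
  have split: "(\<integral>\<^sup>+t. g t * indicator {x..<z} t \<partial>lborel)
      = (\<integral>\<^sup>+t. g t * indicator {x..<y} t \<partial>lborel) + (\<integral>\<^sup>+t. g t * indicator {y..<z} t \<partial>lborel)"
    if "x \<le> y" "y \<le> z" for x y z
    using that by (subst nn_integral_add[symmetric]) (auto intro!: nn_integral_cong simp: indicator_def)
  have "(\<integral>\<^sup>+z. f (c * z) \<partial>circ) = (\<integral>\<^sup>+t. g (t + a) * indicator {0..<2 * pi} t \<partial>lborel)"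
    by (subst nn_integral_circ)
       (auto intro!: nn_integral_cong simp: indicator_def g_def a(3) cis_mult add.commute)
  also have "\<dots> = (\<integral>\<^sup>+t. g t * indicator {a..<2 * pi} t \<partial>lborel)
      + (\<integral>\<^sup>+t. g t * indicator {0 + 2 * pi..<a + 2 * pi} t \<partial>lborel)"
    unfolding shift using split[of a "2 * pi" "2 * pi + a"] a by (simp add: add.commute)
  also have "(\<integral>\<^sup>+t. g t * indicator {0 + 2 * pi..<a + 2 * pi} t \<partial>lborel)
      = (\<integral>\<^sup>+t. g t * indicator {0..<a} t \<partial>lborel)"
    by (simp only: shift[symmetric] per)
  also have "(\<integral>\<^sup>+t. g t * indicator {a..<2 * pi} t \<partial>lborel) + \<dots>
      = (\<integral>\<^sup>+t. g t * indicator {0..<2 * pi} t \<partial>lborel)"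
    using split[of 0 a "2 * pi"] a by (simp add: add.commute)
  also have "\<dots> = (\<integral>\<^sup>+z. f z \<partial>circ)"
    by (subst nn_integral_circ) (auto intro!: nn_integral_cong simp: indicator_def g_def)
  finally show ?thesis .
qed

lemma unimodular_root:
  assumes "cmod w = 1" "n \<ge> 1"
  obtains v where "cmod v = 1" "v ^ n = w"
proof
  have "cis (Arg2pi w) = w" using Arg2pi[of w] assms by (simp add: cis_conv_exp is_Arg_def)
  thus "cis (Arg2pi w / n) ^ n = w" using assms by (simp add: Complex.DeMoivre)
qed simp

text \<open>
  Rotating by an \<open>n\<close>-th root of \<open>w\<close> gives the integrals of \<open>f (z\<^sup>n)\<close> and of \<open>f (z\<^sup>n w)\<close> the same
  value for every unimodular \<open>w\<close>. Averaging over \<open>w\<close> first turns the latter into the integral of \<open>f\<close>.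
\<close>

lemma nn_integral_circ_power:
  assumes [measurable]: "f \<in> borel_measurable borel" and n: "n \<ge> 1"
  shows "(\<integral>\<^sup>+z. f (z ^ n) \<partial>circ) = (\<integral>\<^sup>+z. f z \<partial>circ)"
proof -
  have *: "(\<integral>\<^sup>+z. f (z ^ n * w) \<partial>circ) = (\<integral>\<^sup>+z. f (z ^ n) \<partial>circ)" if w: "cmod w = 1" for w
  proof -
    obtain v where v: "cmod v = 1" "v ^ n = w" using unimodular_root[OF w n] .
    have "(\<integral>\<^sup>+z. f ((v * z) ^ n) \<partial>circ) = (\<integral>\<^sup>+z. f (z ^ n) \<partial>circ)"
      by (rule nn_integral_circ_rotate) (simp_all add: v)
    thus ?thesis by (simp add: power_mult_distrib v mult.commute)
  qed
  have "(\<integral>\<^sup>+z. f (z ^ n) \<partial>circ) = (\<integral>\<^sup>+w. (\<integral>\<^sup>+z. f (z ^ n) \<partial>circ) \<partial>circ)"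
    by (simp add: circ.emeasure_space_1[simplified])
  also have "\<dots> = (\<integral>\<^sup>+w. (\<integral>\<^sup>+z. f (z ^ n * w) \<partial>circ) \<partial>circ)"
    by (rule nn_integral_cong_AE, rule eventually_mono[OF AE_circ]) (simp add: *)
  also have "\<dots> = (\<integral>\<^sup>+z. (\<integral>\<^sup>+w. f (z ^ n * w) \<partial>circ) \<partial>circ)"
    by (rule circ2.Fubini') simp
  also have "\<dots> = (\<integral>\<^sup>+z. (\<integral>\<^sup>+w. f w \<partial>circ) \<partial>circ)"
    by (rule nn_integral_cong_AE, rule eventually_mono[OF AE_circ])
       (simp add: nn_integral_circ_rotate norm_power)
  also have "\<dots> = (\<integral>\<^sup>+z. f z \<partial>circ)" by (simp add: circ.emeasure_space_1[simplified])
  finally show ?thesis .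
qed

section \<open>Logarithmic means of polynomials on the circle\<close>

definition zero_free_disc :: "complex poly \<Rightarrow> bool" where
  "zero_free_disc P \<longleftrightarrow> (\<forall>z. cmod z < 1 \<longrightarrow> poly P z \<noteq> 0)"

lemma zero_free_disc_nonzero: "zero_free_disc P \<Longrightarrow> poly P 0 \<noteq> 0"
  by (simp add: zero_free_disc_def)

text \<open>
  The distance of \<open>1 - w\<close> to \<open>1 - r w\<close> is \<open>1 - r\<close>, which is at most \<open>\<bar>1 - r w\<bar>\<close>. This bounds the logarithms
  on smaller circles from below uniformly in \<open>r\<close>.
\<close>

lemma norm_one_minus_lower:
  assumes "cmod w = 1" "0 \<le> r" "r \<le> 1"
  shows "cmod (1 - w) \<le> 2 * cmod (1 - of_real r * w)"
proof -
  have "cmod (1 - w) = cmod ((1 - of_real r * w) - of_real (1 - r) * w)"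
    by (simp add: algebra_simps)
  also have "\<dots> \<le> cmod (1 - of_real r * w) + cmod (of_real (1 - r) * w)"
    by (rule norm_triangle_ineq4)
  also have "cmod (of_real (1 - r) * w) = 1 - r"
    using assms by (simp only: norm_mult norm_of_real) simp
  also have "1 - r \<le> cmod (1 - of_real r * w)"
    using norm_triangle_ineq2[of 1 "of_real r * w"] assms by (simp add: norm_mult)
  finally show ?thesis by simp
qed

text \<open>
  The mean value property of the holomorphic function \<open>Ln (1 - a z)\<close>, which vanishes at \<open>0\<close>.
\<close>

lemma jensen_linear_interior:
  assumes "cmod a < 1"
  shows "integrable circ (\<lambda>z. ln (cmod (1 - a * z)))" "(\<integral>z. ln (cmod (1 - a * z)) \<partial>circ) = 0"
proof -
  have ne: "cmod (a * z) < 1" if "cmod z \<le> 1" for z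
    using mult_mono[of "cmod a" "cmod a" "cmod z" 1] assms that by (simp add: norm_mult)
  have re: "Re (1 - a * z) > 0" if "cmod z \<le> 1" for z
    using ne[OF that] complex_Re_le_cmod[of "a * z"] by simp
  have nonpos: "1 - a * z \<notin> \<real>\<^sub>\<le>\<^sub>0" if "cmod z \<le> 1" for z
    using re[OF that] complex_nonpos_Reals_iff[of "1 - a * z"] by linarith
  have nz: "cmod (1 - a * cis t) \<noteq> 0" for t
    using ne[of "cis t"] by auto
  have cont: "continuous_on {0..2 * pi} (\<lambda>t. ln (cmod (1 - a * cis t)))"
    by (intro continuous_intros ballI nz)
  have "((\<lambda>u. Ln (1 - a * u) / (u - 0)) has_contour_integral (2 * of_real pi * \<i> * Ln (1 - a * 0)))
          (circlepath 0 1)"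
    by (rule Cauchy_integral_circlepath_simple)
       (use nonpos in \<open>auto intro!: holomorphic_intros\<close>)
  hence "((\<lambda>t. Ln (1 - a * cis t) * \<i>) has_integral 0) {0..2 * pi}"
    unfolding circlepath_def by (subst (asm) has_contour_integral_part_circlepath_iff) simp_all
  from has_integral_mult_left[OF this, of "- \<i>"]
  have "((\<lambda>t. Ln (1 - a * cis t)) has_integral 0) {0..2 * pi}"
    by (simp add: mult.assoc)
  from has_integral_linear[OF this bounded_linear_Re]
  have "((\<lambda>t. Re (Ln (1 - a * cis t))) has_integral 0) {0..2 * pi}"
    by (simp add: o_def)
  moreover have "Re (Ln (1 - a * cis t)) = ln (cmod (1 - a * cis t))" for t
    using ne[of "cis t"] by (intro Re_Ln) auto
  ultimately have "((\<lambda>t. ln (cmod (1 - a * cis t))) has_integral 0) {0..2 * pi}" by simp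
  moreover have "set_integrable lborel {0..2 * pi} (\<lambda>t. ln (cmod (1 - a * cis t)))"
    by (rule borel_integrable_atLeastAtMost'[OF cont])
  ultimately have "(LBINT t:{0..2 * pi}. ln (cmod (1 - a * cis t))) = 0"
    by (metis set_borel_integral_eq_integral(2) integral_unique)
  thus "(\<integral>z. ln (cmod (1 - a * z)) \<partial>circ) = 0"
    by (subst integral_circ[symmetric]) simp_all
  show "integrable circ (\<lambda>z. ln (cmod (1 - a * z)))"
  proof (rule circ.integrable_const_bound)
    define d where "d = 1 - cmod a"
    have d: "0 < d" "d \<le> 1" using assms by (auto simp: d_def)
    show "AE z in circ. norm (ln (cmod (1 - a * z))) \<le> max (ln 2) (- ln d)"
    proof (rule eventually_mono[OF AE_circ])
      fix z :: complex assume z: "cmod z = 1"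
      have "d \<le> cmod (1 - a * z)" "cmod (1 - a * z) \<le> 2"
        using norm_triangle_ineq2[of 1 "a * z"] norm_triangle_ineq4[of 1 "a * z"] z assms
        by (auto simp: d_def norm_mult)
      hence "ln d \<le> ln (cmod (1 - a * z))" "ln (cmod (1 - a * z)) \<le> ln 2"
        using d by (auto intro!: ln_mono)
      thus "norm (ln (cmod (1 - a * z))) \<le> max (ln 2) (- ln d)" by auto
    qed
  qed simp
qed

text \<open>
  Now there is a logarithmic singularity on the circle. The functions \<open>ln \<bar>1 - r a z\<bar>\<close> with \<open>r < 1\<close> have
  mean \<open>0\<close> and are at most \<open>ln 2\<close>; Fatou's lemma applied to \<open>ln 2\<close> minus them makes the limit integrable,
  and then dominated convergence carries the mean \<open>0\<close> over to it.
\<close>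

lemma jensen_linear_boundary:
  assumes a: "cmod a = 1"
  shows "integrable circ (\<lambda>z. ln (cmod (1 - a * z)))" "(\<integral>z. ln (cmod (1 - a * z)) \<partial>circ) = 0"
proof -
  have a0: "a \<noteq> 0" using a by auto
  define r where "r = (\<lambda>k::nat. 1 - 1 / (real k + 2))"
  define f where "f = (\<lambda>k z. ln (cmod (1 - (of_real (r k) * a) * z)))"
  define g where "g = (\<lambda>z. ln (cmod (1 - a * z)))"
  have [measurable]: "f k \<in> borel_measurable borel" "g \<in> borel_measurable borel" for k
    by (auto simp: f_def g_def)
  have r: "0 \<le> r k" "r k < 1" for k by (auto simp: r_def field_simps)
  have r_lim: "r \<longlonglongrightarrow> 1" unfolding r_def by real_asymp
  have fk: "integrable circ (f k)" "(\<integral>z. f k z \<partial>circ) = 0" for k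
    unfolding f_def using r[of k] a by (intro jensen_linear_interior; simp add: norm_mult)+
  have good: "AE z in circ. cmod z = 1 \<and> 1 - a * z \<noteq> 0"
  proof -
    have "AE z in circ. z \<noteq> 1 / a" by (rule AE_circ_neq)
    thus ?thesis using AE_circ
      by eventually_elim (use a0 in \<open>auto simp: eq_divide_eq mult.commute\<close>)
  qed
  have lim: "AE z in circ. (\<lambda>k. f k z) \<longlonglongrightarrow> g z"
  proof (rule eventually_mono[OF good])
    fix z assume z: "cmod z = 1 \<and> 1 - a * z \<noteq> 0"
    have "(\<lambda>k. 1 - (of_real (r k) * a) * z) \<longlonglongrightarrow> 1 - (of_real 1 * a) * z"
      by (intro tendsto_intros r_lim)
    thus "(\<lambda>k. f k z) \<longlonglongrightarrow> g z"
      unfolding f_def g_def using z by (intro tendsto_ln tendsto_norm) auto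
  qed
  have up: "f k z \<le> ln 2" and low: "g z - ln 2 \<le> f k z"
    if z: "cmod z = 1 \<and> 1 - a * z \<noteq> 0" for k z
  proof -
    have "cmod (1 - (of_real (r k) * a) * z) \<le> 1 + cmod (of_real (r k) * a * z)"
      using norm_triangle_ineq4[of 1 "of_real (r k) * a * z"] by simp
    also have "\<dots> \<le> 2" using r[of k] a z by (simp add: norm_mult)
    finally have u: "cmod (1 - (of_real (r k) * a) * z) \<le> 2" .
    have l: "cmod (1 - a * z) \<le> 2 * cmod (1 - (of_real (r k) * a) * z)"
      using norm_one_minus_lower[of "a * z" "r k"] r[of k] a z by (simp add: norm_mult mult.assoc)
    have p0: "0 < cmod (1 - a * z)" using z by simp
    have p: "0 < cmod (1 - (of_real (r k) * a) * z)" using l p0 by linarith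
    show "f k z \<le> ln 2" unfolding f_def using u p by (subst ln_le_cancel_iff) auto
    have "g z \<le> ln (2 * cmod (1 - (of_real (r k) * a) * z))"
      unfolding g_def using l p p0 by (subst ln_le_cancel_iff) auto
    also have "\<dots> = ln 2 + f k z" unfolding f_def using p by (subst ln_mult) auto
    finally show "g z - ln 2 \<le> f k z" by simp
  qed
  have g_up: "AE z in circ. g z \<le> ln 2"
    using lim good by eventually_elim (use up in \<open>blast intro: LIMSEQ_le_const2\<close>)
  \<comment> \<open>integrability of the limit comes from Fatou, since the approximants all have mean \<open>0\<close>\<close>
  have "(\<integral>\<^sup>+z. ennreal (ln 2 - g z) \<partial>circ) = (\<integral>\<^sup>+z. liminf (\<lambda>k. ennreal (ln 2 - f k z)) \<partial>circ)"
    using lim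
    by (intro nn_integral_cong_AE, eventually_elim)
       (intro lim_imp_Liminf[symmetric] tendsto_ennrealI tendsto_intros, simp_all)
  also have "\<dots> \<le> liminf (\<lambda>k. \<integral>\<^sup>+z. ennreal (ln 2 - f k z) \<partial>circ)"
    by (rule nn_integral_liminf) simp
  also have "(\<lambda>k. \<integral>\<^sup>+z. ennreal (ln 2 - f k z) \<partial>circ) = (\<lambda>k. ennreal (ln 2))"
  proof
    fix k
    have "(\<integral>\<^sup>+z. ennreal (ln 2 - f k z) \<partial>circ) = ennreal (\<integral>z. ln 2 - f k z \<partial>circ)"
      using fk up by (intro nn_integral_eq_integral eventually_mono[OF good]) auto
    also have "(\<integral>z. ln 2 - f k z \<partial>circ) = ln 2"
      using fk by (subst Bochner_Integration.integral_diff) (auto simp: circ.prob_space[simplified])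
    finally show "(\<integral>\<^sup>+z. ennreal (ln 2 - f k z) \<partial>circ) = ennreal (ln 2)" .
  qed
  finally have fin: "(\<integral>\<^sup>+z. ennreal (ln 2 - g z) \<partial>circ) < \<infinity>"
    by (simp add: Liminf_const le_less_trans)
  have "integrable circ (\<lambda>z. ln 2 - g z)"
    using fin g_up by (intro integrableI_nonneg eventually_mono[OF g_up]) simp_all
  from Bochner_Integration.integrable_diff[OF circ.integrable_const[of "ln 2"] this]
  have "integrable circ (\<lambda>z. ln 2 - (ln 2 - g z))" .
  moreover have "integrable circ (\<lambda>z. ln 2 - (ln 2 - g z)) = integrable circ g"
    by (rule arg_cong[where f = "integrable circ"]) auto
  ultimately have gi: "integrable circ g" by blast
  thus "integrable circ (\<lambda>z. ln (cmod (1 - a * z)))" by (simp add: g_def)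
  have "(\<lambda>k. \<integral>z. f k z \<partial>circ) \<longlonglongrightarrow> (\<integral>z. g z \<partial>circ)"
  proof (rule integral_dominated_convergence[where w = "\<lambda>z. \<bar>g z\<bar> + ln 2"])
    show "integrable circ (\<lambda>z. \<bar>g z\<bar> + ln 2)" using gi by auto
    show "AE z in circ. norm (f k z) \<le> \<bar>g z\<bar> + ln 2" for k
    proof (rule eventually_mono[OF good])
      fix z assume "cmod z = 1 \<and> 1 - a * z \<noteq> 0"
      from up[OF this, of k] low[OF this, of k]
      show "norm (f k z) \<le> \<bar>g z\<bar> + ln 2" by auto
    qed
  qed (use lim in auto)
  hence "(\<integral>z. g z \<partial>circ) = 0" using fk by (simp add: LIMSEQ_const_iff)
  thus "(\<integral>z. ln (cmod (1 - a * z)) \<partial>circ) = 0" by (simp add: g_def)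
qed

lemma jensen_linear:
  assumes "cmod a \<le> 1"
  shows "integrable circ (\<lambda>z. ln (cmod (1 - a * z)))" "(\<integral>z. ln (cmod (1 - a * z)) \<partial>circ) = 0"
  using jensen_linear_interior[of a] jensen_linear_boundary[of a] assms by (cases "cmod a = 1"; simp)+

lemma poly_root_induct_complex [case_names const root]:
  fixes P :: "complex poly"
  assumes const: "\<And>c. Q [:c:]" and root: "\<And>a P. Q P \<Longrightarrow> Q ([:-a, 1:] * P)"
  shows "Q P"
proof (induction "degree P" arbitrary: P)
  case 0
  then obtain c where "P = [:c:]" by (metis degree_eq_zeroE)
  thus ?case using const by simp
next
  case (Suc n)
  obtain a where "poly P a = 0"
    using fundamental_theorem_of_algebra_alt[of P] Suc.hyps(2)
    by (metis degree_pCons_0 nat.distinct(1))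
  then obtain S where S: "P = [:-a, 1:] * S" by (meson dvdE poly_eq_0_iff_dvd)
  hence "S \<noteq> 0" using Suc.hyps(2) by auto
  hence "degree S = n" using Suc.hyps(2) S by (simp add: degree_mult_eq del: mult_pCons_left)
  thus ?case using Suc.hyps(1) S root by blast
qed

lemma jensen_zero_free:
  assumes "zero_free_disc P"
  shows "integrable circ (\<lambda>z. ln (cmod (poly P z))) \<and>
         (\<integral>z. ln (cmod (poly P z)) \<partial>circ) = ln (cmod (poly P 0))"
  using assms
proof (induction P rule: poly_root_induct_complex)
  case (const c)
  thus ?case by (simp add: circ.prob_space[simplified])
next
  case (root a P)
  have P: "zero_free_disc P" using root.prems by (auto simp: zero_free_disc_def)
  have a: "cmod a \<ge> 1" using root.prems by (force simp: zero_free_disc_def not_le)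
  hence a0: "a \<noteq> 0" by auto
  note IH = root.IH[OF P]
  have lin: "integrable circ (\<lambda>z. ln (cmod (1 - 1 / a * z)))"
            "(\<integral>z. ln (cmod (1 - 1 / a * z)) \<partial>circ) = 0"
    using jensen_linear[of "1 / a"] a by (simp_all add: norm_divide divide_le_eq_1)
  define h where "h = (\<lambda>z. ln (cmod a) + ln (cmod (1 - 1 / a * z)) + ln (cmod (poly P z)))"
  have eq: "AE z in circ. ln (cmod (poly ([:-a, 1:] * P) z)) = h z"
  proof -
    have "P \<noteq> 0" using zero_free_disc_nonzero[OF P] by auto
    hence "AE z in circ. poly P z \<noteq> 0" by (rule AE_circ_poly)
    moreover have "AE z in circ. z \<noteq> a" by (rule AE_circ_neq)
    ultimately show ?thesis
    proof eventually_elim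
      case (elim z)
      have "poly ([:-a, 1:] * P) z = (- a) * (1 - 1 / a * z) * poly P z"
        using a0 by (simp add: field_simps)
      moreover have "1 - 1 / a * z \<noteq> 0" using elim a0 by (auto simp: field_simps)
      ultimately show ?case
        using elim a0 by (simp add: norm_mult ln_mult h_def del: mult_pCons_left)
    qed
  qed
  have h: "integrable circ h" "(\<integral>z. h z \<partial>circ) = ln (cmod a) + ln (cmod (poly P 0))"
    unfolding h_def using lin IH by (auto simp: circ.prob_space[simplified])
  have "integrable circ (\<lambda>z. ln (cmod (poly ([:-a, 1:] * P) z)))"
    using h(1) by (subst integrable_cong_AE[OF _ _ eq]) (simp_all add: h_def)
  moreover have "(\<integral>z. ln (cmod (poly ([:-a, 1:] * P) z)) \<partial>circ) = (\<integral>z. h z \<partial>circ)"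
    by (rule integral_cong_AE[OF _ _ eq]) (simp_all add: h_def)
  moreover have "ln (cmod (poly ([:-a, 1:] * P) 0)) = ln (cmod a) + ln (cmod (poly P 0))"
    using a0 zero_free_disc_nonzero[OF P] by (simp add: norm_mult ln_mult)
  ultimately show ?case using h(2) by metis
qed

text \<open>
  The identity behind all comparisons between a zero and its mirror image in the circle.
\<close>

lemma norm_reflected_factor:
  "cmod (1 - cnj a * z) ^ 2 - cmod (z - a) ^ 2 = (1 - cmod z ^ 2) * (1 - cmod a ^ 2)"
  unfolding cmod_power2 by (simp add: power2_eq_square algebra_simps)

lemma norm_reflected_factor_circle:
  assumes "cmod z = 1" shows "cmod (1 - cnj a * z) = cmod (z - a)"
  using norm_reflected_factor[of a z] assms by (simp add: power2_eq_iff_nonneg)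

lemma norm_reflected_factor_disc:
  assumes "cmod z \<le> 1" "cmod a \<le> 1" shows "cmod (z - a) \<le> cmod (1 - cnj a * z)"
proof -
  have "0 \<le> (1 - cmod z ^ 2) * (1 - cmod a ^ 2)"
    using assms by (intro mult_nonneg_nonneg) (simp_all add: power_le_one)
  thus ?thesis using norm_reflected_factor[of a z] by (intro power2_le_imp_le[OF _ norm_ge_zero]) linarith
qed

lemma norm_reflected_factor_disc':
  assumes "cmod z \<le> 1" "1 \<le> cmod a" shows "cmod (1 - cnj a * z) \<le> cmod (z - a)"
proof -
  have "(1 - cmod z ^ 2) * (1 - cmod a ^ 2) \<le> 0"
    using assms by (intro mult_nonneg_nonpos) (simp_all add: power_le_one one_le_power)
  thus ?thesis using norm_reflected_factor[of a z] by (intro power2_le_imp_le[OF _ norm_ge_zero]) linarith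
qed

text \<open>
  Each factor \<open>z - a\<close> with \<open>\<bar>a\<bar> < 1\<close> is replaced by \<open>1 - cnj a z\<close>: the quotient of the two is a Blaschke
  factor, of modulus at most \<open>1\<close> in the disc and equal to \<open>1\<close> on the circle.
\<close>

lemma reflect_zeros:
  assumes "P \<noteq> 0"
  shows "\<exists>T. zero_free_disc T \<and> degree T \<le> degree P \<and>
           (\<forall>z. cmod z = 1 \<longrightarrow> cmod (poly T z) = cmod (poly P z)) \<and>
           (\<forall>z. cmod z \<le> 1 \<longrightarrow> cmod (poly P z) \<le> cmod (poly T z))"
  using assms
proof (induction P rule: poly_root_induct_complex)
  case (const c)
  thus ?case by (intro exI[of _ "[:c:]"]) (auto simp: zero_free_disc_def)
next
  case (root a P)
  then obtain T where T: "zero_free_disc T" "degree T \<le> degree P"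
    "\<And>z. cmod z = 1 \<Longrightarrow> cmod (poly T z) = cmod (poly P z)"
    "\<And>z. cmod z \<le> 1 \<Longrightarrow> cmod (poly P z) \<le> cmod (poly T z)"
    by (metis mult_zero_right)
  have P: "P \<noteq> 0" using root.prems by auto
  have deg: "degree ([:-a, 1:] * P) = Suc (degree P)"
    using P by (simp add: degree_mult_eq del: mult_pCons_left)
  define L where "L = (if cmod a < 1 then [:1, - cnj a:] else [:-a, 1:])"
  have "degree L \<le> 1" by (simp add: L_def)
  hence "degree (L * T) \<le> degree ([:-a, 1:] * P)"
    using T(2) degree_mult_le[of L T] deg by linarith
  moreover have "zero_free_disc (L * T)"
    unfolding zero_free_disc_def
  proof (intro allI impI)
    fix z :: complex assume z: "cmod z < 1"
    have "poly L z \<noteq> 0"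
    proof (cases "cmod a < 1")
      case True
      hence "cmod (z * cnj a) < 1" using z mult_strict_mono'[of "cmod z" 1 "cmod a" 1] by (simp add: norm_mult)
      hence "z * cnj a \<noteq> 1" by auto
      thus ?thesis using True by (auto simp: L_def)
    qed (use z in \<open>auto simp: L_def\<close>)
    thus "poly (L * T) z \<noteq> 0" using T(1) z by (auto simp: zero_free_disc_def)
  qed
  moreover have poly_root: "poly ([:-a, 1:] * P) z = (z - a) * poly P z" for z
    by (simp add: algebra_simps)
  moreover have "cmod (poly (L * T) z) = cmod (poly ([:-a, 1:] * P) z)" if "cmod z = 1" for z
    using T(3)[OF that] norm_reflected_factor_circle[OF that, of a]
    unfolding poly_root by (auto simp: L_def norm_mult mult.commute)
  moreover have "cmod (poly ([:-a, 1:] * P) z) \<le> cmod (poly (L * T) z)" if "cmod z \<le> 1" for z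
  proof -
    have "cmod (z - a) \<le> cmod (poly L z)"
      using norm_reflected_factor_disc[OF that, of a] by (auto simp: L_def mult.commute)
    thus ?thesis unfolding poly_root poly_mult norm_mult
      by (intro mult_mono T(4)[OF that]) auto
  qed
  ultimately show ?case by blast
qed

lemma integrable_ln_poly:
  assumes "P \<noteq> 0" shows "integrable circ (\<lambda>z. ln (cmod (poly P z)))"
proof -
  obtain T where T: "zero_free_disc T" "\<And>z. cmod z = 1 \<Longrightarrow> cmod (poly T z) = cmod (poly P z)"
    using reflect_zeros[OF assms] by blast
  have "AE z in circ. ln (cmod (poly P z)) = ln (cmod (poly T z))"
    using AE_circ by eventually_elim (simp add: T)
  thus ?thesis using jensen_zero_free[OF T(1)] by (subst integrable_cong_AE) auto
qed

lemma integral_ln_poly_mono: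
  assumes "P \<noteq> 0" "\<And>z. cmod z = 1 \<Longrightarrow> cmod (poly P z) \<le> cmod (poly T z)" "T \<noteq> 0"
  shows "(\<integral>z. ln (cmod (poly P z)) \<partial>circ) \<le> (\<integral>z. ln (cmod (poly T z)) \<partial>circ)"
proof (rule integral_mono_AE)
  show "AE z in circ. ln (cmod (poly P z)) \<le> ln (cmod (poly T z))"
    using AE_circ AE_circ_poly[OF assms(1)] AE_circ_poly[OF assms(3)]
    by eventually_elim (simp add: assms)
qed (use assms integrable_ln_poly in auto)

text \<open>
  Of the two linear polynomials \<open>x + a w\<close> and \<open>a + cnj x w\<close>, which have the same modulus on the circle,
  one has no zero in the disc, and Jensen's formula picks out its constant term. Read from right to left,
  this writes the truncated logarithm \<open>ln (max \<bar>x\<bar> a)\<close> as a mean of plain logarithms.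
\<close>

lemma jensen_max:
  assumes "a > (0::real)"
  shows "integrable circ (\<lambda>w. ln (cmod (x + w * of_real a)))"
    "(\<integral>w. ln (cmod (x + w * of_real a)) \<partial>circ) = ln (max (cmod x) a)"
proof -
  have "integrable circ (\<lambda>w. ln (cmod (x + w * of_real a))) \<and>
    (\<integral>w. ln (cmod (x + w * of_real a)) \<partial>circ) = ln (max (cmod x) a)"
  proof (cases "a \<le> cmod x")
    case True
    have "zero_free_disc [:x, of_real a:]"
      unfolding zero_free_disc_def
    proof (intro allI impI notI)
      fix z assume z: "cmod z < 1" and "poly [:x, of_real a:] z = 0"
      hence "x = - (z * of_real a)" by (simp add: eq_neg_iff_add_eq_0)
      hence "cmod x = cmod z * a" using assms by (simp add: norm_mult)
      also have "\<dots> < a" using z assms by simp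
      finally show False using True by simp
    qed
    from jensen_zero_free[OF this] True show ?thesis by (simp add: max_def)
  next
    case False
    have zf: "zero_free_disc [:of_real a, cnj x:]"
      unfolding zero_free_disc_def
    proof (intro allI impI notI)
      fix z assume z: "cmod z < 1" and "poly [:of_real a, cnj x:] z = 0"
      hence "of_real a = - (z * cnj x)" by (simp add: eq_neg_iff_add_eq_0)
      hence "cmod (of_real a) = cmod (- (z * cnj x))" by (rule arg_cong)
      hence "a = cmod z * cmod x" using assms by (simp add: norm_mult)
      also have "\<dots> \<le> cmod x" using z mult_right_mono[of "cmod z" 1 "cmod x"] by simp
      finally show False using False by simp
    qed
    have ae: "AE w in circ. ln (cmod (x + w * of_real a)) = ln (cmod (poly [:of_real a, cnj x:] w))"
      using AE_circ
    proof eventually_elim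
      case (elim w)
      have "w * cnj w = 1" using elim by (simp flip: complex_norm_square)
      hence "w * cnj (x + w * of_real a) = poly [:of_real a, cnj x:] w"
        by (simp add: algebra_simps flip: mult.assoc)
      moreover have "cmod (w * cnj (x + w * of_real a)) = cmod (x + w * of_real a)"
        using elim by (simp add: norm_mult del: complex_cnj_add)
      ultimately show ?case by simp
    qed
    show ?thesis
      using jensen_zero_free[OF zf] False assms
      by (subst integrable_cong_AE[OF _ _ ae], simp, simp, subst integral_cong_AE[OF _ _ ae])
         (simp_all add: max_def)
  qed
  thus "integrable circ (\<lambda>w. ln (cmod (x + w * of_real a)))"
    "(\<integral>w. ln (cmod (x + w * of_real a)) \<partial>circ) = ln (max (cmod x) a)" by auto
qed

section \<open>Multiplier operators and the inequalities of de Bruijn, Springer and Arestov\<close>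

text \<open>
  Coefficientwise multiplication by \<open>\<mu>\<close> on polynomials of degree at most \<open>n\<close>. The operators \<open>B\<close>, dilations
  and reversals all act in this way, so that sums and duals of them stay within one family.
\<close>

definition mult_op :: "nat \<Rightarrow> (nat \<Rightarrow> complex) \<Rightarrow> complex poly \<Rightarrow> complex poly" where
  "mult_op n \<mu> P = (\<Sum>j\<le>n. monom (\<mu> j * coeff P j) j)"

lemma coeff_mult_op: "coeff (mult_op n \<mu> P) j = (if j \<le> n then \<mu> j * coeff P j else 0)"
  by (simp add: mult_op_def coeff_sum)

lemma mult_op_add: "mult_op n \<mu> (P + Q) = mult_op n \<mu> P + mult_op n \<mu> Q"
  by (rule poly_eqI) (simp add: coeff_mult_op algebra_simps)

lemma mult_op_diff: "mult_op n \<mu> (P - Q) = mult_op n \<mu> P - mult_op n \<mu> Q"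
  by (rule poly_eqI) (simp add: coeff_mult_op algebra_simps)

lemma mult_op_smult: "mult_op n \<mu> (smult c P) = smult c (mult_op n \<mu> P)"
  by (rule poly_eqI) (simp add: coeff_mult_op)

lemma mult_op_const: "mult_op n \<mu> [:c:] = [:\<mu> 0 * c:]"
  by (rule poly_eqI) (simp add: coeff_mult_op coeff_pCons split: nat.splits)

lemma poly_mult_op_0: "poly (mult_op n \<mu> P) 0 = \<mu> 0 * poly P 0"
  by (simp add: poly_0_coeff_0 coeff_mult_op)

lemma degree_mult_op: "degree (mult_op n \<mu> P) \<le> n"
  by (intro degree_le) (simp add: coeff_mult_op)

definition preserves_zero_free :: "nat \<Rightarrow> (nat \<Rightarrow> complex) \<Rightarrow> bool" where
  "preserves_zero_free n \<mu> \<longleftrightarrow>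
     (\<forall>P. degree P \<le> n \<longrightarrow> zero_free_disc P \<longrightarrow> zero_free_disc (mult_op n \<mu> P))"

lemma poly_le_on_cball:
  assumes "\<And>z. cmod z < 1 \<Longrightarrow> cmod (poly P z) \<le> cmod (poly Q z)" and z: "cmod z \<le> 1"
  shows "cmod (poly P z) \<le> cmod (poly Q z)"
proof -
  have "(\<lambda>k. of_real (1 - 1 / (real k + 2)) * z) \<longlonglongrightarrow> of_real 1 * z"
    by (intro tendsto_intros) real_asymp
  hence l: "(\<lambda>k. of_real (1 - 1 / (real k + 2)) * z) \<longlonglongrightarrow> z" by simp
  have "cmod (of_real (1 - 1 / (real k + 2)) * z) < 1" for k
  proof -
    have "cmod (of_real (1 - 1 / (real k + 2)) * z) = (1 - 1 / (real k + 2)) * cmod z"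
      by (simp only: norm_mult norm_of_real) (simp add: field_simps)
    also have "\<dots> \<le> (1 - 1 / (real k + 2)) * 1"
      using z by (intro mult_left_mono) (auto simp: field_simps)
    also have "\<dots> < 1" by simp
    finally show ?thesis .
  qed
  thus ?thesis
    by (intro LIMSEQ_le[OF tendsto_norm[OF isCont_tendsto_compose[OF poly_isCont l]]
                           tendsto_norm[OF isCont_tendsto_compose[OF poly_isCont l]]])
       (use assms(1) in blast)
qed

lemma norm_le_of_no_cancel:
  assumes "\<And>w. cmod w < 1 \<Longrightarrow> b + w * a \<noteq> (0::complex)"
  shows "cmod a \<le> cmod b"
proof (rule ccontr)
  assume "\<not> cmod a \<le> cmod b"
  hence lt: "cmod b < cmod a" by simp
  hence "0 < cmod a" by (rule le_less_trans[OF norm_ge_zero])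
  with lt have "a \<noteq> 0" "cmod (- b / a) < 1" by (simp_all add: norm_divide)
  with assms[of "- b / a"] show False by simp
qed

text \<open>
  If \<open>\<bar>P\<bar> \<le> \<bar>T\<bar>\<close> in the disc and \<open>T\<close> has no zeros there, then neither has \<open>T + w P\<close> for \<open>\<bar>w\<bar> < 1\<close>; the
  operator keeps all of these zero-free, so \<open>w\<close> times the image of \<open>P\<close> never cancels the image of \<open>T\<close>.
\<close>

lemma preserves_zero_free_dominated:
  assumes M: "preserves_zero_free n \<mu>"
    and deg: "degree P \<le> n" "degree T \<le> n" and T: "zero_free_disc T"
    and le: "\<And>z. cmod z < 1 \<Longrightarrow> cmod (poly P z) \<le> cmod (poly T z)"
    and z: "cmod z \<le> 1"
  shows "cmod (poly (mult_op n \<mu> P) z) \<le> cmod (poly (mult_op n \<mu> T) z)"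
proof (rule poly_le_on_cball[OF _ z])
  fix z :: complex assume z: "cmod z < 1"
  show "cmod (poly (mult_op n \<mu> P) z) \<le> cmod (poly (mult_op n \<mu> T) z)"
  proof (rule norm_le_of_no_cancel)
    fix w :: complex assume w: "cmod w < 1"
    have "zero_free_disc (T + smult w P)"
      unfolding zero_free_disc_def
    proof (intro allI impI notI)
      fix x assume x: "cmod x < 1" and "poly (T + smult w P) x = 0"
      hence "poly T x = - (w * poly P x)" by (simp add: eq_neg_iff_add_eq_0)
      hence "cmod (poly T x) = cmod w * cmod (poly P x)" by (simp add: norm_mult)
      also have "\<dots> \<le> cmod w * cmod (poly T x)" by (intro mult_left_mono le x) simp
      also have "\<dots> < 1 * cmod (poly T x)"
        using T w x by (intro mult_strict_right_mono) (auto simp: zero_free_disc_def)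
      finally show False by simp
    qed
    moreover have "degree (T + smult w P) \<le> n"
      using deg by (intro degree_add_le) (auto intro: order.trans[OF degree_smult_le])
    ultimately have "zero_free_disc (mult_op n \<mu> (T + smult w P))"
      using M by (simp add: preserves_zero_free_def)
    thus "poly (mult_op n \<mu> T) z + w * poly (mult_op n \<mu> P) z \<noteq> 0"
      using z by (simp add: zero_free_disc_def mult_op_add mult_op_smult)
  qed
qed

text \<open>
  The zeros of \<open>P\<close> in the disc are reflected, giving \<open>T\<close>. The image of \<open>P\<close> is dominated by that of \<open>T\<close>,
  which is zero-free, so its logarithmic mean is read off at the origin, where the operator is
  multiplication by \<open>\<mu> 0\<close>.
\<close>

lemma de_bruijn_springer:
  assumes M: "preserves_zero_free n \<mu>" and deg: "degree P \<le> n" and ne: "mult_op n \<mu> P \<noteq> 0"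
  shows "(\<integral>z. ln (cmod (poly (mult_op n \<mu> P) z)) \<partial>circ) \<le> (\<integral>z. ln (cmod (\<mu> 0 * poly P z)) \<partial>circ)"
proof -
  have P: "P \<noteq> 0" using ne by (auto simp: mult_op_def)
  obtain T where T: "zero_free_disc T" "degree T \<le> degree P"
    "\<And>z. cmod z = 1 \<Longrightarrow> cmod (poly T z) = cmod (poly P z)"
    "\<And>z. cmod z \<le> 1 \<Longrightarrow> cmod (poly P z) \<le> cmod (poly T z)"
    using reflect_zeros[OF P] by blast
  have MT: "zero_free_disc (mult_op n \<mu> T)"
    using M T deg by (auto simp: preserves_zero_free_def)
  have mu: "\<mu> 0 \<noteq> 0" using zero_free_disc_nonzero[OF MT] by (auto simp: poly_mult_op_0)
  have T': "zero_free_disc (smult (\<mu> 0) T)" using T(1) mu by (simp add: zero_free_disc_def)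
  have "(\<integral>z. ln (cmod (poly (mult_op n \<mu> P) z)) \<partial>circ) \<le> (\<integral>z. ln (cmod (poly (mult_op n \<mu> T) z)) \<partial>circ)"
  proof (rule integral_ln_poly_mono[OF ne])
    show "mult_op n \<mu> T \<noteq> 0" using zero_free_disc_nonzero[OF MT] by auto
    show "cmod (poly (mult_op n \<mu> P) z) \<le> cmod (poly (mult_op n \<mu> T) z)" if "cmod z = 1" for z
      using T deg that by (intro preserves_zero_free_dominated[OF M]) auto
  qed
  also have "\<dots> = (\<integral>z. ln (cmod (poly (smult (\<mu> 0) T) z)) \<partial>circ)"
    using jensen_zero_free[OF MT] jensen_zero_free[OF T'] by (simp add: poly_mult_op_0)
  also have "\<dots> = (\<integral>z. ln (cmod (\<mu> 0 * poly P z)) \<partial>circ)"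
    by (intro integral_cong_AE eventually_mono[OF AE_circ]) (auto simp: norm_mult T)
  finally show ?thesis .
qed

lemma poly_bounded_on_circle: "\<exists>B>0. \<forall>z. cmod z = 1 \<longrightarrow> cmod (poly P z) \<le> B"
proof -
  have "compact (poly P ` sphere 0 1)"
    by (intro compact_continuous_image continuous_intros) auto
  then obtain B where "\<And>z. cmod z = 1 \<Longrightarrow> cmod (poly P z) \<le> B"
    by (metis bounded_iff compact_imp_bounded dist_0_norm imageI mem_sphere)
  thus ?thesis by (intro exI[of _ "max B 1"]) (auto simp: le_max_iff_disj)
qed

lemma continuous_ln_max:
  "a > 0 \<Longrightarrow> continuous_on UNIV (\<lambda>z. ln (max (cmod (poly P z)) a))"
  by (intro continuous_intros) (auto simp: max_def)

text \<open>
  Adding the constant \<open>w a\<close> to the image of \<open>P\<close> is the same as adding \<open>w a / \<mu> 0\<close> to \<open>P\<close>. The inequality of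
  de Bruijn and Springer for these shifted polynomials, averaged over the unimodular \<open>w\<close>, turns by
  \<open>jensen_max\<close> into an inequality for \<open>ln (max \<bar>\<cdot>\<bar> a)\<close>.
\<close>

lemma arestov_ln_max:
  assumes M: "preserves_zero_free n \<mu>" and deg: "degree P \<le> n" and a: "a > (0::real)"
  shows "(\<integral>z. ln (max (cmod (poly (mult_op n \<mu> P) z)) a) \<partial>circ)
       \<le> (\<integral>z. ln (max (cmod (\<mu> 0 * poly P z)) a) \<partial>circ)"
proof -
  define F where "F = mult_op n \<mu> P"
  define G where "G = smult (\<mu> 0) P"
  have "zero_free_disc (mult_op n \<mu> [:1:])"
    using M unfolding preserves_zero_free_def by (auto simp: zero_free_disc_def)
  hence mu: "\<mu> 0 \<noteq> 0" by (auto dest: zero_free_disc_nonzero simp: mult_op_const)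
  have shift: "F + [:w * of_real a:] = mult_op n \<mu> (P + [:w * of_real a / \<mu> 0:])" for w
    using mu by (simp add: F_def mult_op_add mult_op_const)
  have step: "(\<integral>z. ln (cmod (poly F z + w * of_real a)) \<partial>circ)
            \<le> (\<integral>z. ln (cmod (poly G z + w * of_real a)) \<partial>circ)"
    if "F + [:w * of_real a:] \<noteq> 0" for w
  proof -
    have "degree (P + [:w * of_real a / \<mu> 0:]) \<le> n"
      using deg by (intro degree_add_le) auto
    from de_bruijn_springer[OF M this] that show ?thesis
      unfolding shift[symmetric] using mu by (simp add: G_def algebra_simps)
  qed
  have AE_ne: "AE w in circ. H + [:w * of_real a:] \<noteq> 0" for H
  proof -
    have "AE w in circ. w \<noteq> - (coeff H 0) / of_real a" by (rule AE_circ_neq)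
    thus ?thesis
    proof eventually_elim
      case (elim w)
      have "coeff (H + [:w * of_real a:]) 0 \<noteq> 0"
        using elim a by (auto simp: field_simps eq_neg_iff_add_eq_0 add.commute)
      thus ?case by (metis coeff_0)
    qed
  qed
  obtain B1 where B1: "B1 > 0" "\<And>z. cmod z = 1 \<Longrightarrow> cmod (poly F z) \<le> B1"
    using poly_bounded_on_circle[of F] by blast
  obtain B2 where B2: "B2 > 0" "\<And>z. cmod z = 1 \<Longrightarrow> cmod (poly G z) \<le> B2"
    using poly_bounded_on_circle[of G] by blast
  define C where "C = ln (1 + B1 + B2 + a)"
  have C0: "C \<ge> 0" using a B1 B2 by (simp add: C_def)
  have C: "ln (cmod (poly H z + w * of_real a)) \<le> C"
    if "H = F \<or> H = G" "cmod z = 1" "cmod w = 1" for H z w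
  proof (cases "poly H z + w * of_real a = 0")
    case False
    have "cmod (poly H z + w * of_real a) \<le> cmod (poly H z) + a"
      using norm_triangle_ineq[of "poly H z" "w * of_real a"] that a by (simp add: norm_mult)
    also have "\<dots> \<le> 1 + B1 + B2 + a" using that B1(2)[of z] B2(2)[of z] B1(1) B2(1) by auto
    finally show ?thesis unfolding C_def using False by (intro ln_mono) auto
  qed (use C0 in auto)
  have C': "ln (max (cmod (poly H z)) a) \<le> C" if "H = F \<or> H = G" "cmod z = 1" for H z
    unfolding C_def using that B1(2)[of z] B2(2)[of z] B1(1) B2(1) a by (intro ln_mono) auto
  \<comment> \<open>Measuring the deficit below the upper bound \<open>C\<close> makes the integrands nonnegative, so that
      the singularities of the logarithm do not obstruct the exchange of the integrals.\<close>
  have over_w: "(\<integral>\<^sup>+w. \<integral>\<^sup>+z. ennreal (C - ln (cmod (poly H z + w * of_real a))) \<partial>circ \<partial>circ)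
      = ennreal (C - (\<integral>z. ln (max (cmod (poly H z)) a) \<partial>circ))"
    if H: "H = F \<or> H = G" for H
  proof -
    have "(\<integral>\<^sup>+w. \<integral>\<^sup>+z. ennreal (C - ln (cmod (poly H z + w * of_real a))) \<partial>circ \<partial>circ)
        = (\<integral>\<^sup>+z. \<integral>\<^sup>+w. ennreal (C - ln (cmod (poly H z + w * of_real a))) \<partial>circ \<partial>circ)"
      by (rule circ2.Fubini') simp
    also have "\<dots> = (\<integral>\<^sup>+z. ennreal (C - ln (max (cmod (poly H z)) a)) \<partial>circ)"
    proof (rule nn_integral_cong_AE, rule eventually_mono[OF AE_circ])
      fix z :: complex assume z: "cmod z = 1"
      have "(\<integral>\<^sup>+w. ennreal (C - ln (cmod (poly H z + w * of_real a))) \<partial>circ)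
          = ennreal (\<integral>w. C - ln (cmod (poly H z + w * of_real a)) \<partial>circ)"
        using jensen_max(1)[OF a, of "poly H z"] C[OF H z]
        by (intro nn_integral_eq_integral eventually_mono[OF AE_circ]) auto
      also have "(\<integral>w. C - ln (cmod (poly H z + w * of_real a)) \<partial>circ) = C - ln (max (cmod (poly H z)) a)"
        using jensen_max[OF a, of "poly H z"]
        by (subst Bochner_Integration.integral_diff) (auto simp: circ.prob_space[simplified])
      finally show "(\<integral>\<^sup>+w. ennreal (C - ln (cmod (poly H z + w * of_real a))) \<partial>circ)
          = ennreal (C - ln (max (cmod (poly H z)) a))" .
    qed
    also have "\<dots> = ennreal (\<integral>z. C - ln (max (cmod (poly H z)) a) \<partial>circ)"
      using C'[OF H] integrable_circ_continuous[OF continuous_ln_max[OF a, of H]]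
      by (intro nn_integral_eq_integral eventually_mono[OF AE_circ]) auto
    also have "(\<integral>z. C - ln (max (cmod (poly H z)) a) \<partial>circ)
        = C - (\<integral>z. ln (max (cmod (poly H z)) a) \<partial>circ)"
      using integrable_circ_continuous[OF continuous_ln_max[OF a, of H]]
      by (subst Bochner_Integration.integral_diff) (auto simp: circ.prob_space[simplified])
    finally show ?thesis .
  qed
  have over_z: "(\<integral>\<^sup>+z. ennreal (C - ln (cmod (poly H z + w * of_real a))) \<partial>circ)
      = ennreal (C - (\<integral>z. ln (cmod (poly H z + w * of_real a)) \<partial>circ))"
    if H: "H = F \<or> H = G" "cmod w = 1" "H + [:w * of_real a:] \<noteq> 0" for H w
  proof -
    have i: "integrable circ (\<lambda>z. ln (cmod (poly H z + w * of_real a)))"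
      using integrable_ln_poly[OF H(3)] by simp
    have "(\<integral>\<^sup>+z. ennreal (C - ln (cmod (poly H z + w * of_real a))) \<partial>circ)
        = ennreal (\<integral>z. C - ln (cmod (poly H z + w * of_real a)) \<partial>circ)"
      using i C[OF H(1) _ H(2)]
      by (intro nn_integral_eq_integral eventually_mono[OF AE_circ]) auto
    thus ?thesis
      using i by (subst (asm) Bochner_Integration.integral_diff) (auto simp: circ.prob_space[simplified])
  qed
  have "ennreal (C - (\<integral>z. ln (max (cmod (poly G z)) a) \<partial>circ))
      \<le> ennreal (C - (\<integral>z. ln (max (cmod (poly F z)) a) \<partial>circ))"
    unfolding over_w[of F, simplified, symmetric] over_w[of G, simplified, symmetric]
  proof (rule nn_integral_mono_AE)
    show "AE w in circ. (\<integral>\<^sup>+z. ennreal (C - ln (cmod (poly G z + w * of_real a))) \<partial>circ)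
        \<le> (\<integral>\<^sup>+z. ennreal (C - ln (cmod (poly F z + w * of_real a))) \<partial>circ)"
      using AE_ne[of F] AE_ne[of G] AE_circ
      by eventually_elim (subst (1 2) over_z, auto intro!: ennreal_leI step)
  qed
  moreover have "0 \<le> C - (\<integral>z. ln (max (cmod (poly F z)) a) \<partial>circ)"
  proof -
    have "(\<integral>z. ln (max (cmod (poly F z)) a) \<partial>circ) \<le> (\<integral>z. C \<partial>circ)"
      using C'[of F] integrable_circ_continuous[OF continuous_ln_max[OF a, of F]]
      by (intro integral_mono_AE eventually_mono[OF AE_circ]) auto
    thus ?thesis by (simp add: circ.prob_space[simplified])
  qed
  ultimately show ?thesis
    by (subst (asm) ennreal_le_iff) (auto simp: F_def G_def)
qed

text \<open>
  The \<open>p\<close>-th power is a positive mixture of truncated logarithms: substitute \<open>t = ln u - s\<close> in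
  \<open>\<integral> exp (p s) (ln u - s)\<^sup>+ ds\<close>.
\<close>

lemma layer_cake_powr:
  assumes p: "p > (0::real)"
  shows "\<exists>K. 0 < K \<and> (\<forall>u\<ge>0. (\<integral>\<^sup>+s. ennreal (exp (p * s) * (ln (max u (exp s)) - s)) \<partial>lborel)
           = ennreal (K * u powr p))"
proof (intro exI[of _ "1 / p ^ 2"] conjI allI impI)
  show "0 < 1 / p ^ 2" using p by simp
  have base: "(\<integral>\<^sup>+t. ennreal (t * exp (- p * t)) * indicator {0..} t \<partial>lborel) = ennreal (1 / p ^ 2)"
  proof -
    have "(\<integral>\<^sup>+t. ennreal (t * exp (- p * t)) * indicator {0..} t \<partial>lborel)
        = ennreal (0 - (- (0 / p + 1 / p ^ 2) * exp (- p * 0)))"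
    proof (rule nn_integral_FTC_atLeast)
      show "((\<lambda>t. - (t / p + 1 / p ^ 2) * exp (- p * t)) has_real_derivative t * exp (- p * t)) (at t)"
        for t
        using p by (auto intro!: derivative_eq_intros simp: field_simps power2_eq_square)
      show "((\<lambda>t. - (t / p + 1 / p ^ 2) * exp (- p * t)) \<longlongrightarrow> 0) at_top"
        using p by real_asymp
    qed auto
    thus ?thesis by simp
  qed
  fix u :: real assume u: "u \<ge> 0"
  show "(\<integral>\<^sup>+s. ennreal (exp (p * s) * (ln (max u (exp s)) - s)) \<partial>lborel) = ennreal (1 / p ^ 2 * u powr p)"
  proof (cases "u = 0")
    case False
    hence u: "u > 0" using u by simp
    have "(\<integral>\<^sup>+s. ennreal (exp (p * s) * (ln (max u (exp s)) - s)) \<partial>lborel)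
        = (\<integral>\<^sup>+t. ennreal (exp (p * (ln u - t)) * (ln (max u (exp (ln u - t))) - (ln u - t))) \<partial>lborel)"
      by (subst nn_integral_real_affine[where c = "-1" and t = "ln u"]) simp_all
    also have "\<dots> = (\<integral>\<^sup>+t. ennreal (u powr p) * (ennreal (t * exp (- p * t)) * indicator {0..} t) \<partial>lborel)"
    proof (rule nn_integral_cong)
      fix t :: real
      have e: "exp (ln u - t) = u * exp (- t)" using u by (simp add: exp_diff exp_minus field_simps)
      have e2: "exp (p * (ln u - t)) = u powr p * exp (- p * t)"
        using u by (simp add: powr_def exp_add[symmetric] algebra_simps)
      show "ennreal (exp (p * (ln u - t)) * (ln (max u (exp (ln u - t))) - (ln u - t)))
          = ennreal (u powr p) * (ennreal (t * exp (- p * t)) * indicator {0..} t)"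
      proof (cases "t \<ge> 0")
        case True
        hence "max u (exp (ln u - t)) = u" unfolding e using u by (auto simp: max_def)
        thus ?thesis using True by (simp add: e2 ennreal_mult'[symmetric] mult_ac)
      next
        case False
        hence "max u (exp (ln u - t)) = exp (ln u - t)" unfolding e using u by (auto simp: max_def)
        thus ?thesis using False by (simp only: ln_exp) simp
      qed
    qed
    also have "\<dots> = ennreal (u powr p) * ennreal (1 / p ^ 2)"
      by (subst nn_integral_cmult) (simp_all only: base, simp)
    finally show ?thesis by (simp add: ennreal_mult'[symmetric])
  qed (simp add: max_def)
qed

text \<open>
  The inequality for truncated logarithms, integrated over all truncation levels \<open>exp s\<close>.
\<close>

theorem arestov:
  assumes M: "preserves_zero_free n \<mu>" and deg: "degree P \<le> n" and p: "p > 0"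
  shows "(\<integral>\<^sup>+z. ennreal (cmod (poly (mult_op n \<mu> P) z) powr p) \<partial>circ)
       \<le> (\<integral>\<^sup>+z. ennreal (cmod (\<mu> 0 * poly P z) powr p) \<partial>circ)"
proof -
  obtain K where K: "K > 0" and layer: "\<And>u. u \<ge> 0 \<Longrightarrow>
      (\<integral>\<^sup>+s. ennreal (exp (p * s) * (ln (max u (exp s)) - s)) \<partial>lborel) = ennreal (K * u powr p)"
    using layer_cake_powr[OF p] by blast
  interpret pair_sigma_finite circ lborel ..
  have cake: "ennreal K * (\<integral>\<^sup>+z. ennreal (cmod (poly H z) powr p) \<partial>circ)
      = (\<integral>\<^sup>+s. ennreal (exp (p * s) * ((\<integral>z. ln (max (cmod (poly H z)) (exp s)) \<partial>circ) - s)) \<partial>lborel)" for H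
  proof -
    have "ennreal K * (\<integral>\<^sup>+z. ennreal (cmod (poly H z) powr p) \<partial>circ)
        = (\<integral>\<^sup>+z. ennreal K * ennreal (cmod (poly H z) powr p) \<partial>circ)"
      by (rule nn_integral_cmult[symmetric]) simp
    also have "\<dots> = (\<integral>\<^sup>+z. \<integral>\<^sup>+s. ennreal (exp (p * s) * (ln (max (cmod (poly H z)) (exp s)) - s)) \<partial>lborel \<partial>circ)"
      using K by (simp add: layer ennreal_mult'[symmetric])
    also have "\<dots> = (\<integral>\<^sup>+s. \<integral>\<^sup>+z. ennreal (exp (p * s) * (ln (max (cmod (poly H z)) (exp s)) - s)) \<partial>circ \<partial>lborel)"
      by (rule Fubini'[symmetric]) simp
    also have "\<dots> = (\<integral>\<^sup>+s. ennreal (exp (p * s) * ((\<integral>z. ln (max (cmod (poly H z)) (exp s)) \<partial>circ) - s)) \<partial>lborel)"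
    proof (rule nn_integral_cong)
      fix s :: real
      have i: "integrable circ (\<lambda>z. ln (max (cmod (poly H z)) (exp s)))"
        by (intro integrable_circ_continuous continuous_ln_max) simp
      have "s \<le> ln (max u (exp s))" for u using ln_mono[of "exp s" "max u (exp s)"] by simp
      hence "(\<integral>\<^sup>+z. ennreal (exp (p * s) * (ln (max (cmod (poly H z)) (exp s)) - s)) \<partial>circ)
          = ennreal (\<integral>z. exp (p * s) * (ln (max (cmod (poly H z)) (exp s)) - s) \<partial>circ)"
        using i by (intro nn_integral_eq_integral) auto
      also have "(\<integral>z. exp (p * s) * (ln (max (cmod (poly H z)) (exp s)) - s) \<partial>circ)
          = exp (p * s) * ((\<integral>z. ln (max (cmod (poly H z)) (exp s)) \<partial>circ) - s)"
        using i by (simp add: circ.prob_space[simplified])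
      finally show "(\<integral>\<^sup>+z. ennreal (exp (p * s) * (ln (max (cmod (poly H z)) (exp s)) - s)) \<partial>circ)
          = ennreal (exp (p * s) * ((\<integral>z. ln (max (cmod (poly H z)) (exp s)) \<partial>circ) - s))" .
    qed
    finally show ?thesis .
  qed
  have "ennreal K * (\<integral>\<^sup>+z. ennreal (cmod (poly (mult_op n \<mu> P) z) powr p) \<partial>circ)
      \<le> ennreal K * (\<integral>\<^sup>+z. ennreal (cmod (poly (smult (\<mu> 0) P) z) powr p) \<partial>circ)"
    unfolding cake using arestov_ln_max[OF M deg]
    by (intro nn_integral_mono ennreal_leI mult_left_mono diff_right_mono) auto
  thus ?thesis using K by (subst (asm) ennreal_mult_le_mult_iff) auto
qed

section \<open>Duality under conjugate reversal\<close>

lemma poly_mult_op: "poly (mult_op n \<mu> P) z = (\<Sum>j\<le>n. \<mu> j * coeff P j * z ^ j)"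
  by (simp add: mult_op_def poly_sum poly_monom)

lemma poly_eq_sum_le:
  fixes P :: "complex poly"
  assumes "degree P \<le> n"
  shows "poly P z = (\<Sum>j\<le>n. coeff P j * z ^ j)"
  unfolding poly_altdef
  by (rule sum.mono_neutral_left) (use assms in \<open>auto intro: coeff_eq_0\<close>)

text \<open>
  The reciprocal polynomial \<open>z\<^sup>n cnj (P (1 / cnj z))\<close>, formed with respect to the nominal degree \<open>n\<close>.
\<close>

definition conj_reversal :: "nat \<Rightarrow> complex poly \<Rightarrow> complex poly" where
  "conj_reversal n P = (\<Sum>j\<le>n. monom (cnj (coeff P (n - j))) j)"

lemma coeff_conj_reversal: "coeff (conj_reversal n P) j = (if j \<le> n then cnj (coeff P (n - j)) else 0)"
  by (simp add: conj_reversal_def coeff_sum)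

lemma degree_conj_reversal: "degree (conj_reversal n P) \<le> n"
  by (intro degree_le) (simp add: coeff_conj_reversal)

lemma poly_conj_reversal:
  assumes "z \<noteq> 0" "degree P \<le> n"
  shows "poly (conj_reversal n P) z = z ^ n * cnj (poly P (1 / cnj z))"
proof -
  have "poly (conj_reversal n P) z = (\<Sum>j\<le>n. cnj (coeff P (n - j)) * z ^ j)"
    by (simp add: conj_reversal_def poly_sum poly_monom)
  also have "\<dots> = (\<Sum>j\<le>n. cnj (coeff P j) * z ^ (n - j))"
    by (rule sum.reindex_bij_witness[of _ "\<lambda>j. n - j" "\<lambda>j. n - j"]) auto
  also have "\<dots> = (\<Sum>j\<le>n. z ^ n * cnj (coeff P j * (1 / cnj z) ^ j))"
    using assms(1) by (intro sum.cong) (simp_all add: power_diff field_simps)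
  also have "\<dots> = z ^ n * cnj (poly P (1 / cnj z))"
    by (simp add: poly_eq_sum_le[OF assms(2)] sum_distrib_left)
  finally show ?thesis .
qed

lemma norm_conj_reversal_circle:
  assumes "cmod z = 1" "degree P \<le> n"
  shows "cmod (poly (conj_reversal n P) z) = cmod (poly P z)"
proof -
  have "z * cnj z = 1" using assms(1) by (simp flip: complex_norm_square)
  moreover from this have "z \<noteq> 0" by auto
  ultimately have "1 / cnj z = z" "z \<noteq> 0" by (simp_all add: divide_eq_eq)
  thus ?thesis using assms by (simp add: poly_conj_reversal norm_mult norm_power)
qed

text \<open>
  Proved factor by factor: at a reflected point a factor \<open>z - a\<close> turns into \<open>1 - cnj a z\<close>, which is the
  smaller one when \<open>\<bar>a\<bar> \<ge> 1\<close>. The origin, where the point at infinity would be needed, is settled by the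
  leading coefficient.
\<close>

lemma conj_reversal_le:
  assumes P: "zero_free_disc P" and deg: "degree P \<le> n" and z: "cmod z < 1"
  shows "cmod (poly (conj_reversal n P) z) \<le> cmod (poly P z)"
proof -
  have *: "(\<forall>z. z \<noteq> 0 \<longrightarrow> cmod z \<le> 1 \<longrightarrow> cmod z ^ degree P * cmod (poly P (1 / cnj z)) \<le> cmod (poly P z))
      \<and> cmod (lead_coeff P) \<le> cmod (poly P 0)"
    using P
  proof (induction P rule: poly_root_induct_complex)
    case (root a P)
    have P: "zero_free_disc P" using root.prems by (auto simp: zero_free_disc_def)
    have a: "cmod a \<ge> 1" using root.prems by (force simp: zero_free_disc_def not_le)
    have P0: "P \<noteq> 0" using zero_free_disc_nonzero[OF P] by auto
    have deg: "degree ([:-a, 1:] * P) = Suc (degree P)"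
      using P0 by (simp add: degree_mult_eq del: mult_pCons_left)
    have val: "poly ([:-a, 1:] * P) z = (z - a) * poly P z" for z by (simp add: algebra_simps)
    have "cmod z ^ Suc (degree P) * cmod ((1 / cnj z - a) * poly P (1 / cnj z))
        \<le> cmod ((z - a) * poly P z)" if z: "z \<noteq> 0" "cmod z \<le> 1" for z
    proof -
      have "cmod z * cmod (1 / cnj z - a) = cmod (cnj z * (1 / cnj z - a))" by (simp add: norm_mult)
      also have "cnj z * (1 / cnj z - a) = cnj (1 - cnj a * z)" using z(1) by (simp add: field_simps)
      also have "cmod \<dots> \<le> cmod (z - a)"
        unfolding complex_mod_cnj by (rule norm_reflected_factor_disc'[OF z(2) a])
      finally have 1: "cmod z * cmod (1 / cnj z - a) \<le> cmod (z - a)" .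
      have 2: "cmod z ^ degree P * cmod (poly P (1 / cnj z)) \<le> cmod (poly P z)"
        using root.IH[OF P] z by blast
      show ?thesis
        using mult_mono[OF 1 2] by (simp add: norm_mult mult_ac)
    qed
    moreover have "cmod (lead_coeff ([:-a, 1:] * P)) \<le> cmod (poly ([:-a, 1:] * P) 0)"
      unfolding lead_coeff_mult val using root.IH[OF P] a
        mult_mono[of 1 "cmod a" "cmod (lead_coeff P)" "cmod (poly P 0)"]
      by (simp add: norm_mult)
    ultimately show ?case unfolding val deg by blast
  qed simp
  show ?thesis
  proof (cases "z = 0")
    case False
    have "cmod z ^ n * cmod (poly P (1 / cnj z)) \<le> cmod z ^ degree P * cmod (poly P (1 / cnj z))"
      using deg z by (intro mult_right_mono power_decreasing) auto
    also have "\<dots> \<le> cmod (poly P z)" using * False z by auto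
    finally show ?thesis using False deg by (simp add: poly_conj_reversal norm_mult norm_power)
  next
    case True
    have "cmod (coeff P n) \<le> cmod (lead_coeff P)"
      using deg by (cases "degree P = n") (auto simp: coeff_eq_0)
    thus ?thesis using True * by (simp add: poly_0_coeff_0 coeff_conj_reversal)
  qed
qed

text \<open>
  The multiplier obtained by conjugating the operator with \<^const>\<open>conj_reversal\<close>.
\<close>

definition dual_mult :: "nat \<Rightarrow> (nat \<Rightarrow> complex) \<Rightarrow> nat \<Rightarrow> complex" where
  "dual_mult n \<gamma> j = cnj (\<gamma> (n - j))"

lemma mult_op_dual_conj_reversal:
  "mult_op n (dual_mult n \<gamma>) (conj_reversal n P) = conj_reversal n (mult_op n \<gamma> P)"
  by (rule poly_eqI) (simp add: coeff_mult_op coeff_conj_reversal dual_mult_def)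

text \<open>
  The reciprocal of \<open>P\<close> is dominated by \<open>P\<close> in the disc. The dual operator respects this, and it sends
  the reciprocal of \<open>P\<close> to the reciprocal of the image under \<open>\<gamma>\<close>, which has the modulus of that image
  on the circle.
\<close>

lemma mult_op_le_dual:
  assumes M: "preserves_zero_free n (dual_mult n \<gamma>)"
    and P: "zero_free_disc P" and deg: "degree P \<le> n" and z: "cmod z = 1"
  shows "cmod (poly (mult_op n \<gamma> P) z) \<le> cmod (poly (mult_op n (dual_mult n \<gamma>) P) z)"
proof -
  have "cmod (poly (mult_op n (dual_mult n \<gamma>) (conj_reversal n P)) z)
      \<le> cmod (poly (mult_op n (dual_mult n \<gamma>) P) z)"
    using z conj_reversal_le[OF P deg]
    by (intro preserves_zero_free_dominated[OF M degree_conj_reversal deg P]) auto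
  thus ?thesis
    unfolding mult_op_dual_conj_reversal norm_conj_reversal_circle[OF z degree_mult_op] .
qed

text \<open>
  The quotient of the two images is holomorphic on the closed disc, at most \<open>1\<close> in modulus on the circle,
  and strictly smaller than \<open>1\<close> at the origin. By the maximum principle it is smaller than \<open>1\<close> in the
  whole open disc, so a unimodular combination of the images has no zero there.
\<close>

lemma preserves_zero_free_pencil:
  assumes S: "\<And>P z. zero_free_disc P \<Longrightarrow> degree P \<le> n \<Longrightarrow> cmod z \<le> 1 \<Longrightarrow>
                 poly (mult_op n (dual_mult n \<gamma>) P) z \<noteq> 0"
    and lt: "cmod (\<gamma> 0) < cmod (\<gamma> n)" and w: "cmod w = 1"
  shows "preserves_zero_free n (\<lambda>j. \<gamma> j + w * dual_mult n \<gamma> j)"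
  unfolding preserves_zero_free_def
proof (intro allI impI)
  fix P assume deg: "degree P \<le> n" and P: "zero_free_disc P"
  let ?B = "mult_op n \<gamma> P" and ?S = "mult_op n (dual_mult n \<gamma>) P"
  have M: "preserves_zero_free n (dual_mult n \<gamma>)"
    unfolding preserves_zero_free_def zero_free_disc_def using S by (simp add: zero_free_disc_def)
  have split: "mult_op n (\<lambda>j. \<gamma> j + w * dual_mult n \<gamma> j) P = ?B + smult w ?S"
    by (rule poly_eqI) (simp add: coeff_mult_op algebra_simps)
  define f where "f = (\<lambda>z. poly ?B z / poly ?S z)"
  have hol: "f holomorphic_on A" if "A \<subseteq> cball 0 1" for A
    unfolding f_def using S[OF P deg] that by (intro holomorphic_intros) auto
  have le1: "cmod (f z) \<le> 1" if "z \<in> cball 0 1" for z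
  proof (rule maximum_modulus_frontier[of f "cball 0 1"])
    show "f holomorphic_on interior (cball 0 1)" by (rule hol) auto
    show "continuous_on (closure (cball 0 1)) f" by (intro holomorphic_on_imp_continuous_on hol) auto
    show "cmod (f x) \<le> 1" if "x \<in> frontier (cball 0 1)" for x
    proof -
      have x: "cmod x = 1" using that by (simp add: frontier_cball)
      show ?thesis unfolding f_def norm_divide
        using mult_op_le_dual[OF M P deg x] by (intro divide_le_eq_1[THEN iffD2]) auto
    qed
  qed (use that in auto)
  show "zero_free_disc (mult_op n (\<lambda>j. \<gamma> j + w * dual_mult n \<gamma> j) P)"
    unfolding zero_free_disc_def split
  proof (intro allI impI notI)
    fix x assume x: "cmod x < 1" and "poly (?B + smult w ?S) x = 0"
    hence "poly ?B x = - w * poly ?S x" by (simp add: eq_neg_iff_add_eq_0)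
    hence fx: "cmod (f x) = 1" unfolding f_def using S[OF P deg, of x] x w by (simp add: norm_mult)
    have "f constant_on ball 0 1"
    proof (rule maximum_modulus_principle[where U = "ball 0 1" and \<xi> = x])
      show "f holomorphic_on ball 0 1" by (rule hol) auto
      show "cmod (f z) \<le> cmod (f x)" if "z \<in> ball 0 1" for z using le1[of z] that fx by simp
    qed (use x in auto)
    hence "f 0 = f x" using x unfolding constant_on_def by (metis centre_in_ball mem_ball_0 zero_less_one)
    moreover have "cmod (f 0) < 1"
    proof -
      have "0 < cmod (poly P 0)" using zero_free_disc_nonzero[OF P] by simp
      thus ?thesis using lt
        by (simp add: f_def poly_mult_op_0 dual_mult_def norm_divide norm_mult divide_less_eq_1)
    qed
    ultimately show False using fx by simp
  qed
qed

text \<open>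
  Since \<open>\<bar>P\<bar> \<ge> m\<close>, the polynomials \<open>P - c\<close> with \<open>\<bar>c\<bar> < m\<close> are still zero-free, and the unsharpened inequality
  holds for them. Choosing the argument of \<open>c\<close> so that it decreases the right-hand side as much as possible and
  letting \<open>\<bar>c\<bar>\<close> tend to \<open>m\<close> gains the additional term.
\<close>

lemma mult_op_le_dual_sharpened:
  assumes M: "preserves_zero_free n (dual_mult n \<gamma>)"
    and P: "zero_free_disc P" and deg: "degree P \<le> n" and z: "cmod z = 1"
    and le: "cmod (\<gamma> 0) \<le> cmod (\<gamma> n)"
    and m: "0 \<le> m" "\<And>z. cmod z < 1 \<Longrightarrow> m \<le> cmod (poly P z)"
  shows "cmod (poly (mult_op n \<gamma> P) z) + (cmod (\<gamma> n) - cmod (\<gamma> 0)) * m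
       \<le> cmod (poly (mult_op n (dual_mult n \<gamma>) P) z)"
proof (cases "m = 0 \<or> \<gamma> n = 0")
  case True
  hence "(cmod (\<gamma> n) - cmod (\<gamma> 0)) * m = 0" using le by auto
  thus ?thesis using mult_op_le_dual[OF M P deg z] by (simp only: add_0_right)
next
  case False
  hence m0: "m > 0" and gn: "\<gamma> n \<noteq> 0" using m by auto
  let ?B = "mult_op n \<gamma> P" and ?S = "mult_op n (dual_mult n \<gamma>) P"
  have zf: "zero_free_disc (P - [:c:])" if "cmod c < m" for c
    unfolding zero_free_disc_def using m(2) that by fastforce
  have dg: "degree (P - [:c:]) \<le> n" for c using deg by (intro degree_diff_le) auto
  have lower: "m * cmod (\<gamma> n) \<le> cmod (poly ?S z)"
  proof -
    have "cmod (poly [:m * cnj (\<gamma> n):] z) \<le> cmod (poly ?S z)"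
    proof (rule poly_le_on_cball)
      fix x :: complex assume x: "cmod x < 1"
      show "cmod (poly [:m * cnj (\<gamma> n):] x) \<le> cmod (poly ?S x)"
      proof (rule norm_le_of_no_cancel)
        fix w :: complex assume w: "cmod w < 1"
        have "cmod (- w * m) < m" using w m0 by (simp add: norm_mult)
        from zf[OF this] have "zero_free_disc (mult_op n (dual_mult n \<gamma>) (P - [:- w * m:]))"
          using M dg[of "- w * m"] unfolding preserves_zero_free_def by blast
        thus "poly ?S x + w * poly [:m * cnj (\<gamma> n):] x \<noteq> 0"
          using x unfolding mult_op_diff mult_op_const
          by (simp add: zero_free_disc_def dual_mult_def algebra_simps)
      qed
    qed (use z in simp)
    thus ?thesis using m0 by (simp add: norm_mult mult.commute)
  qed
  define X where "X = poly ?S z"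
  have "0 < m * cmod (\<gamma> n)" using m0 gn by simp
  hence X: "X \<noteq> 0" using lower by (auto simp: X_def)
  have "t * ((cmod (\<gamma> n) - cmod (\<gamma> 0)) * m) \<le> cmod X - cmod (poly ?B z)"
    if t: "0 < t" "t < 1" for t :: real
  proof -
    \<comment> \<open>the argument of \<open>c\<close> makes \<open>c * cnj (\<gamma> n)\<close> point in the direction of \<open>X\<close>\<close>
    define c where "c = of_real (t * m * cmod (\<gamma> n) / cmod X) * X / cnj (\<gamma> n)"
    have c: "cmod c = t * m"
      unfolding c_def using X gn m0 t by (simp add: norm_mult norm_divide del: of_real_mult of_real_divide)
    have "cmod c < m" using c t m0 by simp
    from mult_op_le_dual[OF M zf[OF this] dg z]
    have "cmod (poly ?B z - \<gamma> 0 * c) \<le> cmod (X - cnj (\<gamma> n) * c)"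
      unfolding mult_op_diff mult_op_const by (simp add: X_def dual_mult_def)
    also have "X - cnj (\<gamma> n) * c = of_real (1 - t * m * cmod (\<gamma> n) / cmod X) * X"
      unfolding c_def using gn by (simp add: algebra_simps)
    also have "cmod \<dots> = \<bar>1 - t * m * cmod (\<gamma> n) / cmod X\<bar> * cmod X"
      by (simp only: norm_mult norm_of_real)
    also have "\<dots> = cmod X - t * m * cmod (\<gamma> n)"
    proof -
      have "t * m * cmod (\<gamma> n) \<le> 1 * (m * cmod (\<gamma> n))"
        unfolding mult.assoc using t m0 by (intro mult_right_mono) auto
      hence "t * m * cmod (\<gamma> n) / cmod X \<le> 1" using lower X by (simp add: X_def divide_le_eq)
      thus ?thesis using X by (simp add: field_simps)
    qed
    finally have "cmod (poly ?B z - \<gamma> 0 * c) \<le> cmod X - t * m * cmod (\<gamma> n)" .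
    moreover have "cmod (poly ?B z) - cmod (\<gamma> 0) * (t * m) \<le> cmod (poly ?B z - \<gamma> 0 * c)"
      using norm_triangle_ineq2[of "poly ?B z" "\<gamma> 0 * c"] c by (simp add: norm_mult)
    ultimately show ?thesis by (simp add: algebra_simps)
  qed
  hence "(cmod (\<gamma> n) - cmod (\<gamma> 0)) * m \<le> cmod X - cmod (poly ?B z)"
    by (rule field_le_mult_one_interval)
  thus ?thesis by (simp add: X_def)
qed

lemma circle_min_nonneg: "0 \<le> circle_min P"
  unfolding circle_min_def by (rule cINF_greatest) (auto intro: exI[of _ "1::complex"])

lemma circle_min_le: "cmod z = 1 \<Longrightarrow> circle_min P \<le> cmod (poly P z)"
  unfolding circle_min_def by (rule cINF_lower) (auto intro!: bdd_belowI[of _ 0])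

lemma circle_min_le_disc:
  assumes P: "zero_free_disc P" and z: "cmod z < 1"
  shows "circle_min P \<le> cmod (poly P z)"
proof (cases "circle_min P = 0")
  case False
  hence m: "circle_min P > 0" using circle_min_nonneg[of P] by simp
  have nz: "poly P x \<noteq> 0" if "x \<in> cball 0 1" for x
    using P m circle_min_le[of x P] that by (cases "cmod x = 1") (auto simp: zero_free_disc_def)
  have hol: "(\<lambda>x. 1 / poly P x) holomorphic_on A" if "A \<subseteq> cball 0 1" for A
    using nz that by (intro holomorphic_intros) auto
  have "cmod (1 / poly P z) \<le> 1 / circle_min P"
  proof (rule maximum_modulus_frontier[of "\<lambda>x. 1 / poly P x" "cball 0 1"])
    show "(\<lambda>x. 1 / poly P x) holomorphic_on interior (cball 0 1)" by (rule hol) auto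
    show "continuous_on (closure (cball 0 1)) (\<lambda>x. 1 / poly P x)"
      by (intro holomorphic_on_imp_continuous_on hol) auto
    show "cmod (1 / poly P x) \<le> 1 / circle_min P" if "x \<in> frontier (cball 0 1)" for x
      using that m circle_min_le[of x P] by (simp add: frontier_cball norm_divide frac_le)
  qed (use z in auto)
  thus ?thesis using m nz[of z] z by (simp add: norm_divide field_simps)
qed simp

section \<open>Polar derivatives\<close>

lemma coeff_X_pderiv:
  fixes P :: "complex poly"
  shows "coeff ([:0, c:] * pderiv P) j = c * of_nat j * coeff P j"
  by (cases j) (simp_all add: coeff_pderiv coeff_pCons)

lemma coeff_X2_pderiv2:
  fixes P :: "complex poly"
  shows "coeff ([:0, c:] ^ 2 * pderiv (pderiv P)) j = c ^ 2 * of_nat j * (of_nat j - 1) * coeff P j"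
proof (cases j)
  case (Suc k)
  thus ?thesis by (cases k) (simp_all add: coeff_pderiv coeff_pCons power2_eq_square algebra_simps)
qed (simp add: power2_eq_square)

text \<open>
  The Moebius map \<open>a \<mapsto> (u - a) / (z - a)\<close> sends the exterior of the disc to a disc that avoids \<open>0\<close>. Its
  centre is a positive multiple of \<open>C = 1 - u cnj z\<close>, the image of the mirror point of \<open>z\<close>; so it lies in
  the half-plane determined by \<open>C\<close>.
\<close>

lemma laguerre_point:
  assumes u: "cmod u < 1" and z: "cmod z < 1" and a: "1 \<le> cmod a"
  shows "0 < Re (cnj (1 - u * cnj z) * ((u - a) / (z - a)))"
proof -
  define D where "D = 1 - cmod z ^ 2"
  have D: "D > 0" using z by (simp add: D_def abs_square_less_1)
  have za: "z - a \<noteq> 0" using z a by auto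
  define C where "C = 1 - u * cnj z"
  define E where "E = (u - z) * (1 - a * cnj z) / (z - a)"
  have Dc: "of_real D = 1 - z * cnj z" unfolding D_def of_real_diff complex_norm_square by simp
  have "of_real D * ((u - a) / (z - a)) - C = E"
    unfolding Dc C_def E_def using za by (simp add: field_simps)
  hence eq: "of_real D * ((u - a) / (z - a)) = C + E" by (simp add: algebra_simps)
  have "cmod E \<le> cmod (u - z)"
  proof -
    have "cmod (1 - a * cnj z) = cmod (cnj (1 - cnj a * z))" by simp
    also have "\<dots> \<le> cmod (z - a)"
      unfolding complex_mod_cnj using z a by (intro norm_reflected_factor_disc') auto
    finally have "cmod (u - z) * cmod (1 - a * cnj z) \<le> cmod (u - z) * cmod (z - a)"
      by (intro mult_left_mono) auto
    thus ?thesis using za by (simp add: E_def norm_mult norm_divide divide_le_eq)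
  qed
  also have "cmod (u - z) < cmod C"
  proof -
    have "0 < (1 - cmod u ^ 2) * (1 - cmod z ^ 2)"
      using u z by (intro mult_pos_pos) (auto simp: abs_square_less_1)
    hence "cmod (u - z) ^ 2 < cmod (1 - cnj z * u) ^ 2"
      using norm_reflected_factor[of z u] by linarith
    thus ?thesis unfolding C_def by (simp add: mult.commute power2_less_imp_less)
  qed
  finally have EC: "cmod E < cmod C" .
  have "0 < cmod C * (cmod C - cmod E)"
    using EC by (intro mult_pos_pos) (auto intro: le_less_trans[OF norm_ge_zero])
  also have "\<dots> = cmod C ^ 2 - cmod (cnj C * E)" by (simp add: norm_mult power2_eq_square algebra_simps)
  also have "\<dots> \<le> cmod C ^ 2 + Re (cnj C * E)" using abs_Re_le_cmod[of "cnj C * E"] by simp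
  also have "\<dots> = Re (cnj C * (C + E))"
  proof -
    have "cnj C * C = of_real (cmod C ^ 2)" using complex_norm_square[of C] by (metis mult.commute)
    hence "cnj C * (C + E) = of_real (cmod C ^ 2) + cnj C * E" by (simp add: distrib_left)
    thus ?thesis by simp
  qed
  also have "\<dots> = D * Re (cnj C * ((u - a) / (z - a)))"
  proof -
    have "Re (cnj C * (of_real D * X)) = D * Re (cnj C * X)" for X by (simp add: algebra_simps)
    thus ?thesis unfolding eq[symmetric] .
  qed
  finally show ?thesis using D by (simp add: zero_less_mult_iff C_def)
qed

text \<open>
  Divided by \<open>P z\<close>, the polar derivative is the sum of \<open>(u - a) / (z - a)\<close> over the zeros \<open>a\<close> of \<open>P\<close>, plus \<open>1\<close> for each
  unit by which \<open>degree P\<close> falls short of \<open>n\<close>. All these terms lie in one open half-plane.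
\<close>

lemma laguerre:
  assumes P: "zero_free_disc P" and deg: "degree P \<le> n" and n: "n \<ge> 1"
    and u: "cmod u < 1" and z: "cmod z < 1"
  shows "of_nat n * poly P z + (u - z) * poly (pderiv P) z \<noteq> 0"
proof -
  define c where "c = cnj (1 - u * cnj z)"
  define Phi where "Phi = (\<lambda>P. of_nat (degree P) + (u - z) * poly (pderiv P) z / poly P z)"
  have *: "(degree P = 0 \<longrightarrow> Phi P = 0) \<and> (degree P > 0 \<longrightarrow> 0 < Re (c * Phi P))"
    using P
  proof (induction P rule: poly_root_induct_complex)
    case (root a P)
    have P: "zero_free_disc P" using root.prems by (auto simp: zero_free_disc_def)
    have a: "cmod a \<ge> 1" using root.prems by (force simp: zero_free_disc_def not_le)
    have nz: "poly P z \<noteq> 0" "z - a \<noteq> 0" using P z a by (auto simp: zero_free_disc_def)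
    hence P0: "P \<noteq> 0" by auto
    have deg: "degree ([:-a, 1:] * P) = Suc (degree P)"
      using P0 by (simp add: degree_mult_eq del: mult_pCons_left)
    have val: "poly ([:-a, 1:] * P) z = (z - a) * poly P z" by (simp add: algebra_simps)
    have der: "poly (pderiv ([:-a, 1:] * P)) z = poly P z + (z - a) * poly (pderiv P) z"
      by (subst pderiv_mult) (simp add: pderiv_pCons algebra_simps)
    have "Phi ([:-a, 1:] * P) = Phi P + (u - a) / (z - a)"
      unfolding Phi_def val der deg using nz by (simp add: field_simps)
    moreover have "0 < Re (c * ((u - a) / (z - a)))"
      unfolding c_def by (rule laguerre_point[OF u z a])
    moreover have "0 \<le> Re (c * Phi P)" using root.IH[OF P] by (cases "degree P = 0") auto
    ultimately have "0 < Re (c * Phi ([:-a, 1:] * P))"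
      by (simp only: distrib_left plus_complex.sel)
    thus ?case unfolding deg by simp
  qed (simp add: Phi_def)
  have "cmod (u * cnj z) < 1"
    using mult_strict_mono'[of "cmod u" 1 "cmod z" 1] u z by (simp add: norm_mult)
  hence "Re c > 0" using complex_Re_le_cmod[of "u * cnj z"] by (simp add: c_def)
  have "0 < Re (c * (of_nat (n - degree P) + Phi P))"
  proof (cases "degree P = 0")
    case True
    thus ?thesis using * n \<open>Re c > 0\<close> by simp
  next
    case False
    hence "0 < Re (c * Phi P)" using * by simp
    moreover have "0 \<le> Re (c * of_nat (n - degree P))" using \<open>Re c > 0\<close> by simp
    ultimately show ?thesis by (simp only: distrib_left plus_complex.sel)
  qed
  hence "of_nat (n - degree P) + Phi P \<noteq> 0"
    by (metis less_irrefl mult_zero_right zero_complex.sel(1))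
  moreover have "of_nat n * poly P z + (u - z) * poly (pderiv P) z
      = (of_nat (n - degree P) + Phi P) * poly P z"
    using P z deg by (simp add: Phi_def zero_free_disc_def of_nat_diff field_simps)
  ultimately show ?thesis using P z by (auto simp: zero_free_disc_def)
qed

text \<open>
  The polar derivative with respect to \<open>u\<close> has degree at most \<open>n - 1\<close> and is again zero-free, so Laguerre's
  theorem applies to it with the second pole \<open>v\<close>.
\<close>

lemma laguerre_twice:
  assumes P: "zero_free_disc P" and deg: "degree P \<le> n" and n: "n \<ge> 2"
    and u: "cmod u < 1" and v: "cmod v < 1" and z: "cmod z < 1"
  shows "of_nat n * (of_nat n - 1) * poly P z
       + (of_nat n - 1) * ((u - z) + (v - z)) * poly (pderiv P) z
       + (u - z) * (v - z) * poly (pderiv (pderiv P)) z \<noteq> 0"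
proof -
  define A where "A = smult (of_nat n) P + [:u, -1:] * pderiv P"
  have "zero_free_disc A"
    unfolding zero_free_disc_def
  proof (intro allI impI)
    fix x assume x: "cmod x < 1"
    have "poly A x = of_nat n * poly P x + (u - x) * poly (pderiv P) x"
      by (simp add: A_def algebra_simps)
    thus "poly A x \<noteq> 0" using laguerre[OF P deg _ u x] n by simp
  qed
  moreover have "degree A \<le> n - 1"
  proof (rule degree_le, intro allI impI)
    fix i assume i: "n - 1 < i"
    then obtain k where k: "i = Suc k" by (cases i) auto
    have "coeff P (Suc i) = 0" using deg i by (intro coeff_eq_0) auto
    moreover have "i = n \<or> coeff P i = 0" using deg i by (cases "i = n") (auto intro: coeff_eq_0)
    ultimately show "coeff A i = 0"
      by (auto simp: A_def k coeff_pderiv coeff_pCons algebra_simps)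
  qed
  ultimately have "of_nat (n - 1) * poly A z + (v - z) * poly (pderiv A) z \<noteq> 0"
    using n v z by (intro laguerre) auto
  also have "of_nat (n - 1) * poly A z + (v - z) * poly (pderiv A) z
      = of_nat n * (of_nat n - 1) * poly P z
       + (of_nat n - 1) * ((u - z) + (v - z)) * poly (pderiv P) z
       + (u - z) * (v - z) * poly (pderiv (pderiv P)) z"
  proof -
    have eq: "pderiv A = smult (of_nat n) (pderiv P) + (smult (- 1) (pderiv P) + [:u, -1:] * pderiv (pderiv P))"
      unfolding A_def pderiv_add pderiv_smult pderiv_mult
      by (simp add: pderiv_pCons algebra_simps)
    have "poly (pderiv A) z = (of_nat n - 1) * poly (pderiv P) z + (u - z) * poly (pderiv (pderiv P)) z"
      unfolding eq by (simp add: algebra_simps)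
    moreover have "poly A z = of_nat n * poly P z + (u - z) * poly (pderiv P) z"
      by (simp add: A_def algebra_simps)
    moreover have "of_nat (n - 1) = (of_nat n - 1 :: complex)" using n by (simp add: of_nat_diff)
    ultimately show ?thesis by (simp only:) (simp add: algebra_simps)
  qed
  finally show ?thesis .
qed

text \<open>
  The multiplier of the twofold polar derivative at \<open>z\<close> with the moving poles \<open>(1 - w) z\<close> and \<open>(1 - v) z\<close>,
  normalised to be \<open>1\<close> at \<open>j = 0\<close>. For \<open>n = 1\<close> the last term is \<open>0\<close>, as its numerator vanishes at \<open>j = 0\<close>
  and \<open>j = 1\<close>.
\<close>

definition quad_mult :: "nat \<Rightarrow> complex \<Rightarrow> complex \<Rightarrow> nat \<Rightarrow> complex" where
  "quad_mult n w v j = 1 - (w + v) * of_nat j / of_nat n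
     + w * v * (of_nat j * (of_nat j - 1)) / (of_nat n * (of_nat n - 1))"

lemma poly_quad_mult:
  assumes "degree P \<le> n"
  shows "poly (mult_op n (quad_mult n w v) P) z = poly P z - (w + v) / of_nat n * z * poly (pderiv P) z
     + w * v / (of_nat n * (of_nat n - 1)) * z ^ 2 * poly (pderiv (pderiv P)) z"
proof -
  define d :: complex where "d = of_nat n * (of_nat n - 1)"
  have qm: "quad_mult n w v j = 1 - (w + v) * of_nat j / of_nat n + w * v * (of_nat j * (of_nat j - 1)) / d" for j
    by (simp add: quad_mult_def d_def)
  have eq: "mult_op n (quad_mult n w v) P = P - smult ((w + v) / of_nat n) ([:0, 1:] * pderiv P)
     + smult (w * v / d) ([:0, 1:] ^ 2 * pderiv (pderiv P))"
    by (rule poly_eqI, unfold coeff_add coeff_diff coeff_smult coeff_X_pderiv coeff_X2_pderiv2)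
       (use assms in \<open>auto simp: coeff_mult_op qm algebra_simps not_le coeff_eq_0 diff_divide_distrib\<close>)
  show ?thesis unfolding eq d_def[symmetric] by (simp add: power2_eq_square algebra_simps)
qed

lemma quad_mult_preserves_zero_free:
  assumes w: "cmod (w - 1) \<le> 1" and v: "cmod (v - 1) \<le> 1"
    and n: "n \<ge> 1" and n1: "n = 1 \<Longrightarrow> v = 0"
  shows "preserves_zero_free n (quad_mult n w v)"
  unfolding preserves_zero_free_def zero_free_disc_def
proof (intro allI impI)
  fix P z assume deg: "degree P \<le> n" and z: "cmod z < 1"
    and "\<forall>z. cmod z < 1 \<longrightarrow> poly P z \<noteq> 0"
  hence P: "zero_free_disc P" by (simp add: zero_free_disc_def)
  have pt: "cmod ((1 - x) * z) < 1" if "cmod (x - 1) \<le> 1" for x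
  proof -
    have "cmod (1 - x) * cmod z \<le> 1 * cmod z"
      using that by (intro mult_right_mono) (auto simp: norm_minus_commute)
    thus ?thesis using z by (simp add: norm_mult)
  qed
  show "poly (mult_op n (quad_mult n w v) P) z \<noteq> 0"
  proof (cases "n = 1")
    case True
    have "pderiv (pderiv P) = 0"
      using deg True degree_pderiv[of P] by (auto simp: pderiv_eq_0_iff)
    thus ?thesis
      unfolding poly_quad_mult[OF deg] using laguerre[OF P deg n pt[OF w] z] True n1
      by (simp add: algebra_simps)
  next
    case False
    define q where "q = (of_nat n * (of_nat n - 1) :: complex)"
    have nn: "(of_nat n :: complex) \<noteq> 0" "(of_nat n - 1 :: complex) \<noteq> 0"
      using n False by auto
    have q: "q \<noteq> 0" using nn by (simp add: q_def)
    have "q * poly (mult_op n (quad_mult n w v) P) z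
      = of_nat n * (of_nat n - 1) * poly P z
       + (of_nat n - 1) * (((1 - w) * z - z) + ((1 - v) * z - z)) * poly (pderiv P) z
       + ((1 - w) * z - z) * ((1 - v) * z - z) * poly (pderiv (pderiv P)) z"
    proof -
      have "x * y * (a - (w + v) / x * z * b + w * v / (x * y) * z ^ 2 * c)
          = x * y * a + y * (((1 - w) * z - z) + ((1 - v) * z - z)) * b
            + ((1 - w) * z - z) * ((1 - v) * z - z) * c"
        if "x \<noteq> 0" "y \<noteq> 0" for x y a b c :: complex
        using that by (simp add: field_simps power2_eq_square)
      thus ?thesis unfolding poly_quad_mult[OF deg] q_def using nn by blast
    qed
    also have "\<dots> \<noteq> 0"
      using n False by (intro laguerre_twice[OF P deg _ pt[OF w] pt[OF v] z]) auto
    finally show ?thesis by auto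
  qed
qed

section \<open>The operators B as multipliers\<close>

definition B_mult :: "nat \<Rightarrow> complex \<Rightarrow> complex \<Rightarrow> complex \<Rightarrow> nat \<Rightarrow> complex" where
  "B_mult n l0 l1 l2 j = l0 + l1 * (of_nat n / 2) * of_nat j
     + l2 * (of_nat n / 2) ^ 2 / 2 * (of_nat j * (of_nat j - 1))"

lemma B_mult_0: "B_mult n l0 l1 l2 0 = l0"
  by (simp add: B_mult_def)

lemma B_mult_n: "B_mult n l0 l1 l2 n = Lambda n l0 l1 l2"
  by (simp add: B_mult_def Lambda_def power2_eq_square power3_eq_cube field_simps)

lemma B_op_dilate:
  assumes "degree P \<le> n"
  shows "B_op n l0 l1 l2 (P \<circ>\<^sub>p [:0, of_real R:])
       = mult_op n (\<lambda>j. of_real R ^ j * B_mult n l0 l1 l2 j) P"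
proof (rule poly_eqI)
  fix j
  have "coeff (P \<circ>\<^sub>p [:0, of_real R:]) j = of_real R ^ j * coeff P j"
    by (simp add: coeff_pcompose_linear mult.commute)
  thus "coeff (B_op n l0 l1 l2 (P \<circ>\<^sub>p [:0, of_real R:])) j
      = coeff (mult_op n (\<lambda>j. of_real R ^ j * B_mult n l0 l1 l2 j) P) j"
    unfolding B_op_def coeff_add coeff_smult coeff_X_pderiv coeff_X2_pderiv2 coeff_mult_op
    using assms by (cases "j \<le> n")
       (simp_all add: B_mult_def algebra_simps add_divide_distrib diff_divide_distrib coeff_eq_0)
qed

text \<open>
  Substituting \<open>x = n / 2 * (1 - y)\<close> turns \<open>U x\<close> into \<open>\<Lambda> (1 - w y) (1 - v y)\<close>. A zero \<open>y = 1 / w\<close> corresponds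
  to \<open>x = n / 2 * (1 - 1 / w)\<close>, for which \<open>\<bar>x\<bar> \<le> \<bar>x - n / 2\<bar>\<close> says exactly that \<open>\<bar>w - 1\<bar> \<le> 1\<close>. Hence, up to
  reversal, the operators \<open>B\<close> are twofold polar derivatives whose poles have modulus at most that of \<open>z\<close>.
  Since \<open>n / 2\<close> itself violates the half-plane condition, \<open>\<Lambda> = U (n / 2)\<close> is not \<open>0\<close>.
\<close>

lemma B_params_factor:
  assumes n: "n \<ge> 1" and B: "B_params n l0 l1 l2"
  obtains w v where "cmod (w - 1) \<le> 1" "cmod (v - 1) \<le> 1" "n = 1 \<Longrightarrow> v = 0"
    "l0 = Lambda n l0 l1 l2 * (1 - w) * (1 - v)" "Lambda n l0 l1 l2 \<noteq> 0"
    "\<And>j. j \<le> n \<Longrightarrow> B_mult n l0 l1 l2 (n - j) = Lambda n l0 l1 l2 * quad_mult n w v j"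
proof -
  define N where "N = (of_nat n :: complex)"
  define \<sigma> where "\<sigma> = N / 2"
  define L where "L = Lambda n l0 l1 l2"
  define u1 where "u1 = l1 * N * \<sigma>"
  define u2 where "u2 = l2 * (N * (N - 1) / 2) * \<sigma> ^ 2"
  have N: "N \<noteq> 0" "\<sigma> \<noteq> 0" using n by (auto simp: N_def \<sigma>_def)
  have choose2: "(of_nat (n choose 2) :: complex) = N * (N - 1) / 2"
  proof -
    have "2 * (n choose 2) = n * (n - 1)"
      unfolding choose_two by (rule dvd_mult_div_cancel) auto
    hence "of_nat (2 * (n choose 2)) = (of_nat (n * (n - 1)) :: complex)" by (rule arg_cong)
    thus ?thesis using n by (simp add: N_def of_nat_diff eq_divide_eq mult.commute[of _ 2])
  qed
  have L: "L = l0 + u1 + u2"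
    by (simp add: L_def Lambda_def u1_def u2_def \<sigma>_def N_def power2_eq_square power3_eq_cube field_simps)
  have U: "poly (U_poly n l0 l1 l2) (\<sigma> * y) = l0 + u1 * y + u2 * y ^ 2" for y
    unfolding U_poly_def choose2 u1_def u2_def
    by (simp add: N_def power2_eq_square algebra_simps)
  have root: "cmod y \<le> cmod (y - 1)" if "l0 + u1 * y + u2 * y ^ 2 = 0" for y
  proof -
    have "cmod (\<sigma> * y) \<le> cmod (\<sigma> * y - of_nat n / 2)"
      using B U that unfolding B_params_def by auto
    also have "\<sigma> * y - of_nat n / 2 = \<sigma> * (y - 1)" by (simp add: \<sigma>_def N_def algebra_simps)
    finally show ?thesis using N by (simp add: norm_mult)
  qed
  have L0: "L \<noteq> 0" using root[of 1] by (auto simp: L)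
  \<comment> \<open>\<open>U (\<sigma> * (1 - y)) = L * (1 - \<alpha> * y + \<beta> * y\<^sup>2)\<close>; if the degree drops, \<open>w\<close> or \<open>v\<close> is \<open>0\<close>\<close>
  define \<alpha> where "\<alpha> = (u1 + 2 * u2) / L"
  define \<beta> where "\<beta> = u2 / L"
  define d where "d = csqrt (\<alpha> ^ 2 - 4 * \<beta>)"
  have d: "d ^ 2 = \<alpha> ^ 2 - 4 * \<beta>" by (simp add: d_def)
  have ex: "\<exists>w v. w + v = \<alpha> \<and> w * v = \<beta> \<and> (n = 1 \<longrightarrow> v = 0)"
  proof (cases "n = 1")
    case True
    hence "\<beta> = 0" by (simp add: \<beta>_def u2_def N_def)
    thus ?thesis by (intro exI[of _ \<alpha>] exI[of _ 0]) auto
  next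
    case False
    have "(\<alpha> + d) / 2 * ((\<alpha> - d) / 2) = (\<alpha> ^ 2 - d ^ 2) / 4"
      by (simp add: power2_eq_square algebra_simps)
    also have "\<dots> = \<beta>" unfolding d by simp
    finally show ?thesis using False
      by (intro exI[of _ "(\<alpha> + d) / 2"] exI[of _ "(\<alpha> - d) / 2"]) (simp add: field_simps)
  qed
  then obtain w v where sum: "w + v = \<alpha>" and prod: "w * v = \<beta>" and n1: "n = 1 \<Longrightarrow> v = 0" by blast
  have bound: "cmod (x - 1) \<le> 1" if "x ^ 2 - \<alpha> * x + \<beta> = 0" for x
  proof (cases "x = 0")
    case False
    have "L * (x ^ 2 - \<alpha> * x + \<beta>) = l0 * x ^ 2 + u1 * (x * (x - 1)) + u2 * (x - 1) ^ 2"
      unfolding \<alpha>_def \<beta>_def using L0 by (simp add: field_simps) (simp add: L power2_eq_square algebra_simps)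
    hence "l0 * x ^ 2 + u1 * (x * (x - 1)) + u2 * (x - 1) ^ 2 = 0" using that by simp
    moreover have "x ^ 2 * (l0 + u1 * ((x - 1) / x) + u2 * ((x - 1) / x) ^ 2)
        = l0 * x ^ 2 + u1 * (x * (x - 1)) + u2 * (x - 1) ^ 2"
      using False by (simp add: power2_eq_square field_simps)
    ultimately have "l0 + u1 * ((x - 1) / x) + u2 * ((x - 1) / x) ^ 2 = 0" using False by auto
    from root[OF this] have "cmod ((x - 1) / x) \<le> cmod ((x - 1) / x - 1)" .
    also have "(x - 1) / x - 1 = - 1 / x" using False by (simp add: field_simps)
    finally show ?thesis using False by (simp add: norm_divide divide_right_mono divide_le_cancel)
  qed simp
  have "w ^ 2 - \<alpha> * w + \<beta> = 0" "v ^ 2 - \<alpha> * v + \<beta> = 0"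
    unfolding sum[symmetric] prod[symmetric] by (simp_all add: power2_eq_square algebra_simps)
  note wv = this[THEN bound]
  have "L * (1 - w) * (1 - v) = L * (1 - (w + v) + w * v)" by (simp add: algebra_simps)
  also have "\<dots> = L - (u1 + 2 * u2) + u2" unfolding sum prod \<alpha>_def \<beta>_def using L0 by (simp add: field_simps)
  also have "\<dots> = l0" by (simp add: L)
  finally have l0: "l0 = L * (1 - w) * (1 - v)" by simp
  have "B_mult n l0 l1 l2 (n - j) = L * quad_mult n w v j" if j: "j \<le> n" for j
  proof -
    define J where "J = (of_nat j :: complex)"
    have NJ: "of_nat (n - j) = N - J" using j by (simp add: N_def J_def of_nat_diff)
    have "B_mult n l0 l1 l2 (n - j) = l0 + u1 * (N - J) / N + l2 * \<sigma> ^ 2 / 2 * ((N - J) * (N - J - 1))"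
      unfolding B_mult_def NJ u1_def \<sigma>_def N_def[symmetric] using N by simp
    also have "(N - J) * (N - J - 1) = N * (N - 1) - 2 * J * (N - 1) + J * (J - 1)"
      by (simp add: algebra_simps)
    also have "l0 + u1 * (N - J) / N + l2 * \<sigma> ^ 2 / 2 * (N * (N - 1) - 2 * J * (N - 1) + J * (J - 1))
        = L - (u1 + 2 * u2) * J / N + l2 * \<sigma> ^ 2 / 2 * (J * (J - 1))"
      unfolding L u2_def using N by (simp add: field_simps)
    also have "l2 * \<sigma> ^ 2 / 2 * (J * (J - 1)) = u2 * (J * (J - 1)) / (N * (N - 1))"
    proof (cases "N = 1")
      case True
      hence "n = 1" by (simp add: N_def)
      hence "j = 0 \<or> j = 1" using j by auto
      thus ?thesis using True by (auto simp: J_def)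
    qed (use N in \<open>simp add: u2_def field_simps\<close>)
    also have "L - (u1 + 2 * u2) * J / N + u2 * (J * (J - 1)) / (N * (N - 1))
        = L * (1 - \<alpha> * J / N + \<beta> * (J * (J - 1)) / (N * (N - 1)))"
      unfolding \<alpha>_def \<beta>_def using L0 by (simp add: distrib_left right_diff_distrib)
    finally show ?thesis by (simp add: quad_mult_def sum prod J_def N_def)
  qed
  with wv n1 l0 L0 show thesis unfolding L_def by (rule that)
qed

text \<open>
  Up to the factor \<open>R\<^sup>n cnj \<Lambda>\<close> the dual operator evaluates the twofold polar derivative at \<open>z / R\<close>. As \<open>R > 1\<close>,
  the zero-free region extends beyond the closed disc.
\<close>

lemma dual_dilated_B_nonzero:
  assumes n: "n \<ge> 1" and B: "B_params n l0 l1 l2" and R: "R > 1"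
    and P: "zero_free_disc P" and deg: "degree P \<le> n" and z: "cmod z \<le> 1"
  shows "poly (mult_op n (dual_mult n (\<lambda>j. of_real R ^ j * B_mult n l0 l1 l2 j)) P) z \<noteq> 0"
proof -
  define L where "L = Lambda n l0 l1 l2"
  obtain w v where wv: "cmod (w - 1) \<le> 1" "cmod (v - 1) \<le> 1" "n = 1 \<Longrightarrow> v = 0" "L \<noteq> 0"
    and q: "\<And>j. j \<le> n \<Longrightarrow> B_mult n l0 l1 l2 (n - j) = L * quad_mult n w v j"
    using B_params_factor[OF n B] unfolding L_def by metis
  have conj: "cmod (cnj x - 1) \<le> 1" if "cmod (x - 1) \<le> 1" for x
    using that complex_mod_cnj[of "x - 1"] by simp
  have "poly (mult_op n (dual_mult n (\<lambda>j. of_real R ^ j * B_mult n l0 l1 l2 j)) P) z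
      = (\<Sum>j\<le>n. of_real R ^ n * cnj L * (quad_mult n (cnj w) (cnj v) j * coeff P j * (z / of_real R) ^ j))"
    unfolding poly_mult_op
  proof (rule sum.cong)
    fix j assume "j \<in> {..n}"
    hence j: "j \<le> n" by simp
    have "cnj (quad_mult n w v j) = quad_mult n (cnj w) (cnj v) j" by (simp add: quad_mult_def)
    moreover have "of_real R ^ (n - j) = (of_real R ^ n / of_real R ^ j :: complex)"
      using j R by (simp add: power_diff)
    ultimately show "dual_mult n (\<lambda>j. of_real R ^ j * B_mult n l0 l1 l2 j) j * coeff P j * z ^ j
        = of_real R ^ n * cnj L * (quad_mult n (cnj w) (cnj v) j * coeff P j * (z / of_real R) ^ j)"
      by (simp add: dual_mult_def q[OF j] power_divide)
  qed simp
  also have "\<dots> = of_real R ^ n * cnj L * poly (mult_op n (quad_mult n (cnj w) (cnj v)) P) (z / of_real R)"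
    unfolding poly_mult_op sum_distrib_left ..
  finally have eq: "poly (mult_op n (dual_mult n (\<lambda>j. of_real R ^ j * B_mult n l0 l1 l2 j)) P) z
      = of_real R ^ n * cnj L * poly (mult_op n (quad_mult n (cnj w) (cnj v)) P) (z / of_real R)" .
  have "cmod (z / of_real R) < 1" using z R by (simp add: norm_divide divide_less_eq)
  moreover have "preserves_zero_free n (quad_mult n (cnj w) (cnj v))"
    using wv n by (intro quad_mult_preserves_zero_free conj) auto
  ultimately have "poly (mult_op n (quad_mult n (cnj w) (cnj v)) P) (z / of_real R) \<noteq> 0"
    using P deg by (simp add: preserves_zero_free_def zero_free_disc_def)
  thus ?thesis unfolding eq using wv R by simp
qed

section \<open>Norms of binomials\<close>

text \<open>
  The \<open>p\<close>-th power of the norm as a nonnegative integral, so that Tonelli's theorem applies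
  without integrability conditions.
\<close>

definition circle_power :: "real \<Rightarrow> complex poly \<Rightarrow> ennreal" where
  "circle_power p Q = (\<integral>\<^sup>+z. ennreal (cmod (poly Q z) powr p) \<partial>circ)"

lemma circle_norm_eq_circle_power:
  assumes p: "p > 0"
  shows "circle_norm p Q = enn2real (circle_power p Q) powr (1 / p)" "circle_power p Q < \<infinity>"
proof -
  have i: "integrable circ (\<lambda>z. cmod (poly Q z) powr p)"
    by (intro integrable_circ_continuous continuous_on_powr' continuous_intros) (use p in auto)
  hence eq: "circle_power p Q = ennreal (\<integral>z. cmod (poly Q z) powr p \<partial>circ)"
    unfolding circle_power_def by (intro nn_integral_eq_integral) auto
  thus "circle_power p Q < \<infinity>" by simp
  show "circle_norm p Q = enn2real (circle_power p Q) powr (1 / p)"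
    unfolding eq circle_norm_def using p
    by (subst integral_circ) auto
qed

lemma circle_norm_0:
  assumes "Q \<noteq> 0"
  shows "circle_norm 0 Q = exp (\<integral>z. ln (cmod (poly Q z)) \<partial>circ)"
  unfolding circle_norm_def using assms by (subst integral_circ) auto

lemma circle_norm_0_zero_free:
  assumes "zero_free_disc Q" shows "circle_norm 0 Q = cmod (poly Q 0)"
proof -
  have "poly Q 0 \<noteq> 0" by (rule zero_free_disc_nonzero[OF assms])
  moreover from this have "Q \<noteq> 0" by auto
  ultimately show ?thesis using jensen_zero_free[OF assms] by (simp add: circle_norm_0)
qed

lemma circle_norm_0_mono:
  assumes "\<And>z. cmod z = 1 \<Longrightarrow> cmod (poly Q z) \<le> cmod (poly T z)" "T \<noteq> 0"
  shows "circle_norm 0 Q \<le> circle_norm 0 T"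
proof (cases "Q = 0")
  case True
  thus ?thesis using assms(2) by (simp add: circle_norm_0) (simp add: circle_norm_def)
next
  case False
  thus ?thesis using integral_ln_poly_mono[OF False assms] assms(2) by (simp add: circle_norm_0)
qed

lemma obtain_phase: obtains a where "cmod a = 1" "x = of_real (cmod x) * a"
proof (cases "x = 0")
  case False
  hence "cmod (x / of_real (cmod x)) = 1" "x = of_real (cmod x) * (x / of_real (cmod x))"
    by (simp_all add: norm_divide)
  thus ?thesis by (rule that)
qed (use that[of 1] in simp)

text \<open>
  The phases of \<open>x\<close> and \<open>y\<close> are absorbed by a rotation of \<open>w\<close> and a common unimodular factor.
\<close>

lemma nn_integral_circ_phases:
  "(\<integral>\<^sup>+w. ennreal (cmod (x + w * y) powr p) \<partial>circ)
     = (\<integral>\<^sup>+w. ennreal (cmod (of_real (cmod x) + w * of_real (cmod y)) powr p) \<partial>circ)"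
proof -
  obtain a where a: "cmod a = 1" "x = of_real (cmod x) * a" using obtain_phase .
  obtain b where b: "cmod b = 1" "y = of_real (cmod y) * b" using obtain_phase .
  have ab: "a \<noteq> 0" "b \<noteq> 0" using a(1) b(1) by auto
  have "(\<integral>\<^sup>+w. ennreal (cmod (x + w * y) powr p) \<partial>circ)
      = (\<integral>\<^sup>+w. ennreal (cmod (x + (a / b * w) * y) powr p) \<partial>circ)"
    using a(1) b(1) by (intro nn_integral_circ_rotate[symmetric]) (auto simp: norm_divide)
  also have "\<dots> = (\<integral>\<^sup>+w. ennreal (cmod (of_real (cmod x) + w * of_real (cmod y)) powr p) \<partial>circ)"
  proof (rule nn_integral_cong)
    fix w
    have "x + (a / b * w) * y = a * (of_real (cmod x) + w * of_real (cmod y))"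
      by (subst a(2), subst b(2)) (use ab in \<open>simp add: field_simps\<close>)
    thus "ennreal (cmod (x + (a / b * w) * y) powr p)
        = ennreal (cmod (of_real (cmod x) + w * of_real (cmod y)) powr p)"
      using a(1) by (simp add: norm_mult)
  qed
  finally show ?thesis .
qed

lemma zero_free_binomial:
  assumes "b \<noteq> 0" "cmod a \<le> cmod b" "n \<ge> 1"
  shows "zero_free_disc (monom a n + [:b:])"
  unfolding zero_free_disc_def
proof (intro allI impI notI)
  fix z :: complex assume z: "cmod z < 1" and "poly (monom a n + [:b:]) z = 0"
  hence "b = - (a * z ^ n)" by (simp add: poly_monom eq_neg_iff_add_eq_0 add.commute)
  hence "cmod b = cmod a * cmod z ^ n" by (simp add: norm_mult norm_power)
  also have "\<dots> \<le> cmod b * cmod z ^ n" using assms(2) by (intro mult_right_mono) auto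
  also have "\<dots> < cmod b * 1"
    using assms(1,3) z by (intro mult_strict_left_mono) (auto simp: power_less_one_iff)
  finally show False by simp
qed

lemma conj_reversal_binomial:
  "n \<ge> 1 \<Longrightarrow> conj_reversal n (monom a n + [:b:]) = monom (cnj b) n + [:cnj a:]"
  by (rule poly_eqI) (auto simp: coeff_conj_reversal coeff_pCons split: nat.splits)

text \<open>
  When \<open>\<bar>a\<bar> \<le> \<bar>b\<bar>\<close> the binomial has no zeros in the disc; otherwise its reciprocal has none, and the moduli
  of the two agree on the circle.
\<close>

lemma circle_norm_0_binomial:
  assumes n: "n \<ge> 1"
  shows "circle_norm 0 (monom a n + [:b:]) = max (cmod a) (cmod b)"
proof (cases "cmod a \<le> cmod b")
  case True
  show ?thesis
  proof (cases "b = 0")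
    case False
    show ?thesis using circle_norm_0_zero_free[OF zero_free_binomial[OF False True n]] True n
      by (simp add: poly_monom power_0_left)
  qed (use True in \<open>simp add: circle_norm_def\<close>)
next
  case False
  let ?Q = "monom a n + [:b:]" and ?T = "monom (cnj b) n + [:cnj a:]"
  have T: "zero_free_disc ?T" using False n by (intro zero_free_binomial) auto
  have deg: "degree ?Q \<le> n" by (intro degree_add_le) (auto simp: degree_monom_le)
  have eq: "cmod (poly ?T z) = cmod (poly ?Q z)" if "cmod z = 1" for z
    using norm_conj_reversal_circle[OF that deg] n by (simp only: conj_reversal_binomial)
  have "?T \<noteq> 0" using zero_free_disc_nonzero[OF T] by (metis poly_0)
  moreover have "?Q \<noteq> 0"
  proof
    assume "?Q = 0"
    hence "coeff ?Q n = 0" by simp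
    thus False using False n by (simp add: coeff_pCons split: nat.splits)
  qed
  ultimately have "circle_norm 0 ?Q = circle_norm 0 ?T"
    using eq by (intro antisym circle_norm_0_mono) auto
  thus ?thesis using circle_norm_0_zero_free[OF T] False n by (simp add: poly_monom power_0_left)
qed

lemma circle_power_binomial:
  assumes "n \<ge> 1"
  shows "circle_power p (monom a n + [:b:])
       = (\<integral>\<^sup>+w. ennreal (cmod (of_real (cmod b) + w * of_real (cmod a)) powr p) \<partial>circ)"
proof -
  have "circle_power p (monom a n + [:b:]) = (\<integral>\<^sup>+z. ennreal (cmod (b + z ^ n * a) powr p) \<partial>circ)"
    unfolding circle_power_def by (simp add: poly_monom algebra_simps)
  also have "\<dots> = (\<integral>\<^sup>+z. ennreal (cmod (b + z * a) powr p) \<partial>circ)"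
    by (rule nn_integral_circ_power[OF _ assms]) simp
  finally show ?thesis by (subst (asm) nn_integral_circ_phases)
qed

lemma circle_norm_binomial_cong:
  assumes "0 \<le> p" "n \<ge> 1" "n' \<ge> 1" "cmod a = cmod a'" "cmod b = cmod b'"
  shows "circle_norm p (monom a n + [:b:]) = circle_norm p (monom a' n' + [:b':])"
proof (cases "p = 0")
  case True
  thus ?thesis using assms by (simp add: circle_norm_0_binomial)
next
  case False
  thus ?thesis using assms by (simp add: circle_norm_eq_circle_power(1) circle_power_binomial)
qed

lemma linear_eq_binomial: "[:b, a:] = monom a 1 + [:b :: complex:]"
  by (simp add: monom_Suc monom_0 One_nat_def)

lemma circle_norm_one_plus_pos:
  assumes "0 \<le> p" shows "0 < circle_norm p [:1, 1:]"
proof (cases "p = 0")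
  case True
  thus ?thesis unfolding linear_eq_binomial by (subst True, subst circle_norm_0_binomial) auto
next
  case False
  hence p: "p > 0" using assms by simp
  have "circle_power p [:1, 1:] \<noteq> 0"
  proof
    assume "circle_power p [:1, 1:] = 0"
    hence "AE z in circ. ennreal (cmod (poly [:1, 1:] z) powr p) = 0"
      unfolding circle_power_def by (subst (asm) nn_integral_0_iff_AE) auto
    moreover have "AE z in circ. poly [:1, 1:] z \<noteq> (0 :: complex)" by (rule AE_circ_poly) simp
    ultimately have "AE z in circ. False"
      by eventually_elim (simp del: poly_pCons)
    thus False by (simp add: circ.AE_False[simplified])
  qed
  hence "0 < enn2real (circle_power p [:1, 1:])"
    using circle_norm_eq_circle_power(2)[OF p, of "[:1,1:]"]
    by (simp add: enn2real_positive_iff zero_less_iff_neq_zero)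
  thus ?thesis unfolding circle_norm_eq_circle_power(1)[OF p] by simp
qed

section \<open>Averaging over the pencil\<close>

text \<open>
  Passing from the pair \<open>(f, g)\<close> to the pair \<open>(f + c, g - c)\<close> keeps the sum and brings the radii closer, which
  decreases \<open>\<bar>f + w g\<bar>\<close>; lowering the larger radius to the smaller decreases it further. The displayed
  identity does both at once.
\<close>

lemma norm_one_plus_mult_le:
  fixes f c g :: real and w :: complex
  assumes "0 \<le> f" "0 \<le> c" "f + 2 * c \<le> g" and w: "cmod w = 1"
  shows "(f + c) * cmod (1 + w) \<le> cmod (of_real f + w * of_real g)"
proof (rule power2_le_imp_le)
  have w2: "Re w ^ 2 + Im w ^ 2 = 1" using w by (simp add: cmod_power2[symmetric])
  have "cmod (of_real f + w * of_real g) ^ 2 = (f + g * Re w) ^ 2 + (g * Im w) ^ 2"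
    by (simp add: cmod_power2 mult.commute)
  also have "\<dots> = f ^ 2 + 2 * f * g * Re w + g ^ 2 * (Re w ^ 2 + Im w ^ 2)"
    by (simp add: power2_eq_square algebra_simps)
  finally have 1: "cmod (of_real f + w * of_real g) ^ 2 = f ^ 2 + 2 * f * g * Re w + g ^ 2"
    by (simp add: w2)
  have "cmod (1 + w) ^ 2 = 1 + 2 * Re w + (Re w ^ 2 + Im w ^ 2)"
    unfolding cmod_power2 by (simp add: power2_eq_square algebra_simps)
  hence 2: "cmod (1 + w) ^ 2 = 2 + 2 * Re w" by (simp add: w2)
  have re: "Re w \<le> 1" "- 1 \<le> Re w" using abs_Re_le_cmod[of w] w by auto
  have "f ^ 2 + 2 * f * g * Re w + g ^ 2 - (f + c) ^ 2 * (2 + 2 * Re w)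
      = (g - f) ^ 2 * ((1 - Re w) / 2) + ((f + g) ^ 2 - (2 * (f + c)) ^ 2) * ((1 + Re w) / 2)"
    by (simp add: power2_eq_square field_simps)
  also have "\<dots> \<ge> 0"
  proof -
    have "(2 * (f + c)) ^ 2 \<le> (f + g) ^ 2" using assms by (intro power_mono) auto
    thus ?thesis using re by (intro add_nonneg_nonneg mult_nonneg_nonneg) auto
  qed
  finally show "((f + c) * cmod (1 + w)) ^ 2 \<le> cmod (of_real f + w * of_real g) ^ 2"
    unfolding 1 power_mult_distrib 2 by simp
qed simp

text \<open>
  Integrating the pointwise inequality \<open>\<bar>A\<bar> \<bar>1 + w\<bar> \<le> \<bar>\<bar>B\<bar> + w \<bar>S\<bar>\<bar>\<close> over \<open>z\<close> and \<open>w\<close> produces the norm of \<open>1 + z\<close> on the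
  left. On the right the phases of \<open>B\<close> and \<open>S\<close> may be restored by rotating \<open>w\<close>, after which the integral over
  \<open>z\<close> for fixed \<open>w\<close> is under control.
\<close>

lemma power_mean_combine:
  assumes p: "p > 0"
    and main: "\<And>z. cmod z = 1 \<Longrightarrow>
      cmod (poly A z) \<le> cmod (poly B z) + c \<and> cmod (poly B z) + 2 * c \<le> cmod (poly S z)"
    and c: "0 \<le> c"
    and pencil: "\<And>w. cmod w = 1 \<Longrightarrow>
      circle_power p (B + smult w S) \<le> (\<integral>\<^sup>+z. ennreal (cmod ((x + w * y) * poly P z) powr p) \<partial>circ)"
  shows "circle_power p A * circle_power p [:1, 1:] \<le> circle_power p [:x, y:] * circle_power p P"
proof -
  have one: "circle_power p [:1, 1:] = (\<integral>\<^sup>+w. ennreal (cmod (1 + w) powr p) \<partial>circ)"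
    by (simp add: circle_power_def)
  have "circle_power p A * circle_power p [:1, 1:]
      = (\<integral>\<^sup>+z. (\<integral>\<^sup>+w. ennreal (cmod (poly A z) powr p) * ennreal (cmod (1 + w) powr p) \<partial>circ) \<partial>circ)"
    unfolding one unfolding circle_power_def
    by (subst nn_integral_cmult, simp, subst nn_integral_multc) simp_all
  also have "\<dots> \<le> (\<integral>\<^sup>+z. (\<integral>\<^sup>+w. ennreal (cmod (poly B z + w * poly S z) powr p) \<partial>circ) \<partial>circ)"
  proof (rule nn_integral_mono_AE, rule eventually_mono[OF AE_circ])
    fix z :: complex assume z: "cmod z = 1"
    have "(\<integral>\<^sup>+w. ennreal (cmod (poly A z) powr p) * ennreal (cmod (1 + w) powr p) \<partial>circ)
        \<le> (\<integral>\<^sup>+w. ennreal (cmod (of_real (cmod (poly B z)) + w * of_real (cmod (poly S z))) powr p) \<partial>circ)"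
    proof (rule nn_integral_mono_AE, rule eventually_mono[OF AE_circ])
      fix w :: complex assume w: "cmod w = 1"
      have "cmod (poly A z) * cmod (1 + w) \<le> (cmod (poly B z) + c) * cmod (1 + w)"
        using main[OF z] by (intro mult_right_mono) auto
      also have "\<dots> \<le> cmod (of_real (cmod (poly B z)) + w * of_real (cmod (poly S z)))"
        using main[OF z] c w by (intro norm_one_plus_mult_le) auto
      finally have "(cmod (poly A z) * cmod (1 + w)) powr p
          \<le> cmod (of_real (cmod (poly B z)) + w * of_real (cmod (poly S z))) powr p"
        using p by (intro powr_mono2) auto
      thus "ennreal (cmod (poly A z) powr p) * ennreal (cmod (1 + w) powr p)
          \<le> ennreal (cmod (of_real (cmod (poly B z)) + w * of_real (cmod (poly S z))) powr p)"
        by (simp add: ennreal_mult'[symmetric] powr_mult ennreal_leI)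
    qed
    thus "(\<integral>\<^sup>+w. ennreal (cmod (poly A z) powr p) * ennreal (cmod (1 + w) powr p) \<partial>circ)
        \<le> (\<integral>\<^sup>+w. ennreal (cmod (poly B z + w * poly S z) powr p) \<partial>circ)"
      by (subst nn_integral_circ_phases)
  qed
  also have "\<dots> = (\<integral>\<^sup>+w. (\<integral>\<^sup>+z. ennreal (cmod (poly B z + w * poly S z) powr p) \<partial>circ) \<partial>circ)"
    by (rule circ2.Fubini'[symmetric]) simp
  also have "\<dots> \<le> (\<integral>\<^sup>+w. (\<integral>\<^sup>+z. ennreal (cmod (x + w * y) powr p) * ennreal (cmod (poly P z) powr p) \<partial>circ) \<partial>circ)"
  proof (rule nn_integral_mono_AE, rule eventually_mono[OF AE_circ])
    fix w :: complex assume "cmod w = 1"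
    from pencil[OF this] show "(\<integral>\<^sup>+z. ennreal (cmod (poly B z + w * poly S z) powr p) \<partial>circ)
        \<le> (\<integral>\<^sup>+z. ennreal (cmod (x + w * y) powr p) * ennreal (cmod (poly P z) powr p) \<partial>circ)"
      by (simp add: circle_power_def norm_mult powr_mult ennreal_mult')
  qed
  also have "\<dots> = circle_power p [:x, y:] * circle_power p P"
    unfolding circle_power_def by (subst nn_integral_cmult, simp, subst nn_integral_multc) simp_all
  finally show ?thesis .
qed

lemma circle_min_binomial:
  assumes n: "n \<ge> 1" and ab: "cmod a = 1" "cmod b = 1"
  shows "circle_min (monom a n + [:b:]) = 0"
proof -
  obtain v where v: "cmod v = 1" "v ^ n = - b / a"
    using unimodular_root[of "- b / a" n] n ab by (auto simp: norm_divide)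
  have "poly (monom a n + [:b:]) v = 0" using v ab by (auto simp: poly_monom)
  thus ?thesis
    using circle_min_le[OF v(1), of "monom a n + [:b:]"] circle_min_nonneg[of "monom a n + [:b:]"] by simp
qed

theorem corollary4:
  fixes n :: nat and P :: "complex poly" and l0 l1 l2 \<delta> :: complex and p R :: real
  assumes "n \<ge> 1"
    and "degree P \<le> n"
    and "\<And>z. cmod z < 1 \<Longrightarrow> poly P z \<noteq> 0"
    and "B_params n l0 l1 l2"
    and "cmod \<delta> \<le> 1"
    and "0 \<le> p"
    and "R > 1"
  shows "circle_norm p (perturbed_B n l0 l1 l2 R \<delta> P)
           \<le> circle_norm p [:l0, of_real (R ^ n) * Lambda n l0 l1 l2:] / circle_norm p [:1, 1:]
             * circle_norm p P \<and>
         (\<forall>a b. cmod a = 1 \<and> cmod b = 1 \<longrightarrow>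
           (let Q = monom a n + [:b:] in
             degree Q \<le> n \<and> (\<forall>z. cmod z < 1 \<longrightarrow> poly Q z \<noteq> 0) \<and>
             circle_norm p (perturbed_B n l0 l1 l2 R \<delta> Q)
               = circle_norm p [:l0, of_real (R ^ n) * Lambda n l0 l1 l2:] / circle_norm p [:1, 1:]
                 * circle_norm p Q))"
proof -
  note n = \<open>n \<ge> 1\<close> and deg = \<open>degree P \<le> n\<close> and B = \<open>B_params n l0 l1 l2\<close>
    and R = \<open>R > 1\<close> and p0 = \<open>0 \<le> p\<close>
  have P: "zero_free_disc P" using assms(3) by (simp add: zero_free_disc_def)
  define L where "L = Lambda n l0 l1 l2"
  define y where "y = of_real (R ^ n) * L"
  define \<gamma> where "\<gamma> = (\<lambda>j. of_real R ^ j * B_mult n l0 l1 l2 j)"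
  define m where "m = circle_min P"
  define c where "c = (R ^ n * cmod L - cmod l0) * m / 2"
  define A where "A = perturbed_B n l0 l1 l2 R \<delta> P"
  define BP where "BP = mult_op n \<gamma> P"
  define SP where "SP = mult_op n (dual_mult n \<gamma>) P"
  have \<gamma>0: "\<gamma> 0 = l0" and \<gamma>n: "\<gamma> n = y"
    by (simp_all add: \<gamma>_def B_mult_0 B_mult_n y_def L_def)
  have ny: "cmod y = R ^ n * cmod L" unfolding y_def norm_mult norm_of_real using R by simp
  have lt: "cmod l0 < cmod y"
  proof -
    obtain w v where wv: "cmod (w - 1) \<le> 1" "cmod (v - 1) \<le> 1" "l0 = L * (1 - w) * (1 - v)" "L \<noteq> 0"
      using B_params_factor[OF n B] unfolding L_def by metis
    have "cmod l0 = cmod L * (cmod (w - 1) * cmod (v - 1))"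
      by (simp add: wv(3) norm_mult norm_minus_commute)
    also have "\<dots> \<le> cmod L * (1 * 1)" using wv by (intro mult_left_mono mult_mono) auto
    also have "\<dots> < R ^ n * cmod L" using wv(4) R n by (simp add: one_less_power)
    finally show ?thesis by (simp add: ny)
  qed
  have S: "poly (mult_op n (dual_mult n \<gamma>) T) z \<noteq> 0"
    if "zero_free_disc T" "degree T \<le> n" "cmod z \<le> 1" for T z
    unfolding \<gamma>_def by (rule dual_dilated_B_nonzero[OF n B R that])
  have M: "preserves_zero_free n (dual_mult n \<gamma>)"
    unfolding preserves_zero_free_def
  proof (intro allI impI)
    fix T assume "degree T \<le> n" "zero_free_disc T"
    thus "zero_free_disc (mult_op n (dual_mult n \<gamma>) T)"
      using S[of T] unfolding zero_free_disc_def[of "mult_op n (dual_mult n \<gamma>) T"] by simp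
  qed
  have c0: "0 \<le> c"
    unfolding c_def m_def using lt circle_min_nonneg[of P] by (simp add: ny)
  have A: "poly A z = poly BP z + \<delta> * of_real c" for z
    unfolding A_def perturbed_B_def B_op_dilate[OF deg]
    by (simp add: BP_def \<gamma>_def c_def L_def m_def)
  have A_le: "cmod (poly A z) \<le> cmod (poly BP z) + c" for z
  proof -
    have "cmod (\<delta> * of_real c) \<le> 1 * c"
      unfolding norm_mult using assms(5) c0 by (intro mult_mono) auto
    thus ?thesis unfolding A using norm_triangle_ineq[of "poly BP z" "\<delta> * of_real c"] by simp
  qed
  have S_ge: "cmod (poly BP z) + 2 * c \<le> cmod (poly SP z)" if z: "cmod z = 1" for z
  proof -
    have "cmod (poly BP z) + (cmod (\<gamma> n) - cmod (\<gamma> 0)) * m \<le> cmod (poly SP z)"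
      unfolding BP_def SP_def m_def
      using lt circle_min_nonneg[of P] circle_min_le_disc[OF P]
      by (intro mult_op_le_dual_sharpened[OF M P deg z]) (auto simp: \<gamma>0 \<gamma>n)
    thus ?thesis by (simp add: \<gamma>0 \<gamma>n c_def ny)
  qed
  have SP0: "poly SP 0 = cnj y * poly P 0"
    by (simp add: SP_def poly_mult_op_0 dual_mult_def \<gamma>n)
  have bound: "circle_norm p A \<le> circle_norm p [:l0, y:] / circle_norm p [:1, 1:] * circle_norm p P"
  proof (cases "p = 0")
    case True
    have SP: "zero_free_disc SP" using M P deg by (simp add: SP_def preserves_zero_free_def)
    have "SP \<noteq> 0" using zero_free_disc_nonzero[OF SP] by auto
    have "cmod (poly A z) \<le> cmod (poly SP z)" if "cmod z = 1" for z
      using A_le[of z] S_ge[OF that] c0 by linarith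
    hence "circle_norm 0 A \<le> circle_norm 0 SP"
      using \<open>SP \<noteq> 0\<close> by (intro circle_norm_0_mono)
    also have "\<dots> = cmod y * cmod (poly P 0)"
      by (simp add: circle_norm_0_zero_free[OF SP] SP0 norm_mult)
    also have "\<dots> = circle_norm 0 [:l0, y:] / circle_norm 0 [:1, 1:] * circle_norm 0 P"
      unfolding linear_eq_binomial using lt
      by (simp add: circle_norm_0_binomial circle_norm_0_zero_free[OF P])
    finally show ?thesis using True by simp
  next
    case False
    hence p: "p > 0" using p0 by simp
    have "circle_power p A * circle_power p [:1, 1:] \<le> circle_power p [:l0, cnj y:] * circle_power p P"
    proof (rule power_mean_combine[OF p _ c0])
      show "cmod (poly A z) \<le> cmod (poly BP z) + c \<and> cmod (poly BP z) + 2 * c \<le> cmod (poly SP z)"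
        if "cmod z = 1" for z using A_le S_ge[OF that] by blast
      fix w :: complex assume w: "cmod w = 1"
      have "BP + smult w SP = mult_op n (\<lambda>j. \<gamma> j + w * dual_mult n \<gamma> j) P"
        unfolding BP_def SP_def by (rule poly_eqI) (simp add: coeff_mult_op algebra_simps)
      moreover have "preserves_zero_free n (\<lambda>j. \<gamma> j + w * dual_mult n \<gamma> j)"
        using lt w by (intro preserves_zero_free_pencil S) (auto simp: \<gamma>0 \<gamma>n)
      ultimately show "circle_power p (BP + smult w SP)
          \<le> (\<integral>\<^sup>+z. ennreal (cmod ((l0 + w * cnj y) * poly P z) powr p) \<partial>circ)"
        using arestov[OF _ deg p, of "\<lambda>j. \<gamma> j + w * dual_mult n \<gamma> j"]
        by (simp add: circle_power_def dual_mult_def \<gamma>0 \<gamma>n)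
    qed
    hence "enn2real (circle_power p A * circle_power p [:1, 1:])
        \<le> enn2real (circle_power p [:l0, cnj y:] * circle_power p P)"
      using circle_norm_eq_circle_power(2)[OF p]
      by (intro enn2real_mono) (auto simp: ennreal_mult_less_top)
    hence "(enn2real (circle_power p A) * enn2real (circle_power p [:1, 1:])) powr (1 / p)
        \<le> (enn2real (circle_power p [:l0, cnj y:]) * enn2real (circle_power p P)) powr (1 / p)"
      using p by (intro powr_mono2) (auto simp: enn2real_mult)
    hence "circle_norm p A * circle_norm p [:1, 1:] \<le> circle_norm p [:l0, cnj y:] * circle_norm p P"
      by (simp add: circle_norm_eq_circle_power(1)[OF p] powr_mult)
    moreover have "circle_norm p [:l0, cnj y:] = circle_norm p [:l0, y:]"
      unfolding linear_eq_binomial by (rule circle_norm_binomial_cong[OF p0]) auto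
    ultimately show ?thesis
      using circle_norm_one_plus_pos[OF p0] by (simp add: field_simps)
  qed
  have sharp: "degree Q \<le> n \<and> (\<forall>z. cmod z < 1 \<longrightarrow> poly Q z \<noteq> 0) \<and>
      circle_norm p (perturbed_B n l0 l1 l2 R \<delta> Q)
        = circle_norm p [:l0, y:] / circle_norm p [:1, 1:] * circle_norm p Q"
    if ab: "cmod a = 1" "cmod b = 1" and Q: "Q = monom a n + [:b:]" for a b Q
  proof -
    have degQ: "degree Q \<le> n" unfolding Q by (intro degree_add_le) (auto simp: degree_monom_le)
    have "b \<noteq> 0" using ab by auto
    hence "zero_free_disc Q" unfolding Q using ab n by (intro zero_free_binomial) auto
    moreover have "perturbed_B n l0 l1 l2 R \<delta> Q = monom (y * a) n + [:l0 * b:]"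
    proof -
      have "perturbed_B n l0 l1 l2 R \<delta> Q = mult_op n \<gamma> Q"
        unfolding perturbed_B_def B_op_dilate[OF degQ]
        by (simp add: \<gamma>_def Q circle_min_binomial[OF n ab])
      also have "\<dots> = monom (y * a) n + [:l0 * b:]"
      proof (rule poly_eqI)
        fix j
        show "coeff (mult_op n \<gamma> Q) j = coeff (monom (y * a) n + [:l0 * b:]) j"
          using n by (cases "j = 0"; cases "j = n")
            (auto simp: coeff_mult_op Q coeff_eq_0 \<gamma>0 \<gamma>n[symmetric])
      qed
      finally show ?thesis .
    qed
    moreover have "circle_norm p (monom (y * a) n + [:l0 * b:]) = circle_norm p [:l0, y:]"
      unfolding linear_eq_binomial using n ab
      by (intro circle_norm_binomial_cong p0) (auto simp: norm_mult)
    moreover have "circle_norm p Q = circle_norm p [:1, 1:]"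
      unfolding linear_eq_binomial Q using n ab by (intro circle_norm_binomial_cong p0) auto
    ultimately show ?thesis
      using circle_norm_one_plus_pos[OF p0] degQ by (simp add: zero_free_disc_def)
  qed
  show ?thesis
    using bound sharp unfolding A_def y_def L_def Let_def by blast
qed

end
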